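(* Let $\mathbb{K}\in\{\mathbb{R},\mathbb{C}\}$, let $A,E\in\mathbb{K}^{n\times n}$, put $\widetilde{A}=A+E$, and let $A$ have rank $k\ge1$ and compact SVD $A=W_k\Sigma_kV_k^*$. Let $I,J\subset\{1,\dots,n\}$ with $|I|=|J|=k$, and put $C=A(:,J)$, $R=A(I,:)$, $U=A(I,J)$, $\widetilde{C}=\widetilde{A}(:,J)$, $\widetilde{R}=\widetilde{A}(I,:)$, $\widetilde{U}=\widetilde{A}(I,J)$. Assume $\operatorname{rank}(C)=\operatorname{rank}(U)=\operatorname{rank}(R)=k$. Let $\|\cdot\|$ be a normalized, uniformly generated, unitarily invariant, submultiplicative norm with pseudoinverse perturbation constant $\mu\in[1,3]$ (see context). Put \[ t=\sqrt{1+\frac{k(n-|I|)}{|I|-k+1}}=\sqrt{1+k(n-k)}. \] If $\|E\|\leq\varepsilon$, if $W_k(I,:)$ has maximal volume among all $|I|\times k$ submatrices of $W_k$ and $V_k(J,:)$ has maximal volume among all $|J|\times k$ submatrices of $V_k$, and if in addition $\sigma_k(U)>4\mu\varepsilon$, then \[ \|A-\widetilde{C}\widetilde{U}_k^\dagger\widetilde{R}\|\leq\left(\frac12+3t+\frac92 t^2\right)\varepsilon.\]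
   Context: For a matrix $B$ and index sets $I,J$, $B(I,J)$ is the submatrix with rows in $I$ and columns in $J$; $B(I,:)$ keeps all columns and $B(:,J)$ keeps all rows. $B^\dagger$ is the Moore--Penrose pseudoinverse; $\|B\|_2$ is the spectral norm; $\sigma_i(B)$ is the $i$-th singular value in descending order. $B_k$ denotes the truncated SVD of order $k$ of $B$ (best rank-$k$ approximation), and $B_k^\dagger=(B_k)^\dagger$. The volume of $B\in\mathbb{K}^{p\times q}$ is $\prod_{i=1}^{\min\{p,q\}}\sigma_i(B)$. The compact SVD of a rank-$k$ matrix $A\in\mathbb{K}^{m\times n}$ is $A=W_k\Sigma_kV_k^*$ with $W_k\in\mathbb{K}^{m\times k}$, $V_k\in\mathbb{K}^{n\times k}$ having orthonormal columns and $\Sigma_k$ the $k\times k$ diagonal matrix of the positive singular values in descending order. A "normalized, uniformly generated, unitarily invariant, submultiplicative norm" is a family of norms $\|\cdot\|:\bigcup_{p,q\ge 1}\mathbb{K}^{p\times q}\to\mathbb{R}$ (a norm on each $\mathbb{K}^{p\times q}$) such that: $\|x\|=\|x\|_2$ (Euclidean norm) for every vector $x$ viewed as a matrix (normalized); there is a single symmetric function $\phi$ with $\|B\|=\phi(\sigma_1(B),\dots,\sigma_r(B))$, $r=\operatorname{rank}(B)$, for matrices $B$ of every size (uniformly generated); $\|\cdot\|$ is invariant under left and right multiplication by unitary matrices; and $\|BD\|\le\|B\|\|D\|$ whenever $BD$ is defined. All Schatten $p$-norms, $1\le p\le\infty$, are examples. Pseudoinverse perturbation constant (Stewart): $\mu\in[1,3]$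 is a constant depending only on the norm $\|\cdot\|$ such that for all matrices $B,\widetilde{B}$ of the same size, $\|B^\dagger-\widetilde{B}^\dagger\|\le\mu\|\widetilde{B}^\dagger\|_2\|B^\dagger\|_2\|\widetilde{B}-B\|$ if $\operatorname{rank}(B)=\operatorname{rank}(\widetilde{B})$, and $\|B^\dagger-\widetilde{B}^\dagger\|\le\mu\max\{\|\widetilde{B}^\dagger\|_2^2,\|B^\dagger\|_2^2\}\|\widetilde{B}-B\|$ otherwise. ($\mu=3$ works for every such norm; $\mu=\sqrt2$ for the Frobenius norm, $\mu=\frac{1+\sqrt5}{2}$ for the spectral norm.) *)

theory Defs
  imports
    Complex_Main
    "HOL-Library.Multiset"
    "HOL-Computational_Algebra.Polynomial"
    "Jordan_Normal_Form.Schur_Decomposition"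
    "Jordan_Normal_Form.Char_Poly"
    "Jordan_Normal_Form.DL_Rank"
    "Jordan_Normal_Form.DL_Submatrix"
begin

text \<open>
  The scalar field \<open>K\<close> is a set of complex numbers, either \<open>\<real>\<close> or \<open>UNIV\<close>. Real matrices are
  complex matrices with entries in \<open>\<real>\<close>; on them \<^const>\<open>mat_adjoint\<close> is the transpose, and rank,
  singular values and pseudoinverse are the same over \<open>\<real>\<close> and over the complex numbers.
  Everything that does depend on the field (norms, unitary matrices, singular value
  decompositions) is restricted to \<open>K\<close> explicitly.
\<close>

definition K_mat :: "complex set \<Rightarrow> nat \<Rightarrow> nat \<Rightarrow> complex mat set" where
  "K_mat K p q = {B \<in> carrier_mat p q. elements_mat B \<subseteq> K}"

definition mrank :: "complex mat \<Rightarrow> nat" where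
  "mrank B = vec_space.rank (dim_row B) B"

definition orthonormal_cols :: "complex mat \<Rightarrow> bool" where
  "orthonormal_cols W \<longleftrightarrow> mat_adjoint W * W = 1\<^sub>m (dim_col W)"

definition K_unitary :: "complex set \<Rightarrow> nat \<Rightarrow> complex mat \<Rightarrow> bool" where
  "K_unitary K p Q \<longleftrightarrow>
     Q \<in> K_mat K p p \<and> mat_adjoint Q * Q = 1\<^sub>m p \<and> Q * mat_adjoint Q = 1\<^sub>m p"

text \<open>
  The singular values of a \<open>p \<times> q\<close> matrix \<open>B\<close> are the square roots of the eigenvalues of
  \<open>B\<^sup>* B\<close>, counted with algebraic multiplicity; these eigenvalues are real and nonnegative.
  The list has length \<open>q\<close>; if \<open>q > p\<close>, its last \<open>q - p\<close> entries are zeros beyond the \<open>min p q\<close>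
  singular values proper.
\<close>

definition singular_values :: "complex mat \<Rightarrow> real list" where
  "singular_values B =
     rev (sorted_list_of_multiset
       (image_mset (\<lambda>z. sqrt (Re z)) (proots (char_poly (mat_adjoint B * B)))))"

text \<open>\<open>\<sigma> B i\<close> is the \<open>i\<close>-th largest singular value, counted from \<open>i = 1\<close>.\<close>

definition \<sigma> :: "complex mat \<Rightarrow> nat \<Rightarrow> real" where
  "\<sigma> B i = singular_values B ! (i - 1)"

definition spectral_norm :: "complex mat \<Rightarrow> real" where
  "spectral_norm B = \<sigma> B 1"

definition volume :: "complex mat \<Rightarrow> real" where
  "volume B = (\<Prod>i = 1..min (dim_row B) (dim_col B). \<sigma> B i)"

definition is_pinv :: "complex mat \<Rightarrow> complex mat \<Rightarrow> bool" where
  "is_pinv B X \<longleftrightarrow>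
     X \<in> carrier_mat (dim_col B) (dim_row B) \<and>
     B * X * B = B \<and>
     X * B * X = X \<and>
     mat_adjoint (B * X) = B * X \<and>
     mat_adjoint (X * B) = X * B"

definition pinv :: "complex mat \<Rightarrow> complex mat" where
  "pinv B = (THE X. is_pinv B X)"

definition sv_diag :: "nat \<Rightarrow> nat \<Rightarrow> complex mat \<Rightarrow> complex mat" where
  "sv_diag p q B = mat p q (\<lambda>(i, j). if i = j then complex_of_real (\<sigma> B (i + 1)) else 0)"

definition compact_svd ::
  "complex set \<Rightarrow> nat \<Rightarrow> complex mat \<Rightarrow> complex mat \<Rightarrow> complex mat \<Rightarrow> complex mat \<Rightarrow> bool" where
  "compact_svd K k A W S V \<longleftrightarrow>
     mrank A = k \<and>
     W \<in> K_mat K (dim_row A) k \<and> orthonormal_cols W \<and>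
     V \<in> K_mat K (dim_col A) k \<and> orthonormal_cols V \<and>
     S = sv_diag k k A \<and>
     A = W * S * mat_adjoint V"

text \<open>
  \<open>B\<^sub>k\<close> is unique only if \<open>\<sigma> B k > \<sigma> B (k + 1)\<close> (or \<open>k\<close> is at least the rank of \<open>B\<close>), so it is a
  relation: \<open>Bk\<close> arises by cutting off some singular value decomposition of \<open>B\<close> over \<open>K\<close>.
\<close>

definition truncated_svd :: "complex set \<Rightarrow> nat \<Rightarrow> complex mat \<Rightarrow> complex mat \<Rightarrow> bool" where
  "truncated_svd K k B Bk \<longleftrightarrow>
     (\<exists>W V. K_unitary K (dim_row B) W \<and> K_unitary K (dim_col B) V \<and>
        B = W * sv_diag (dim_row B) (dim_col B) B * mat_adjoint V \<and>
        Bk = submatrix W UNIV {..<k}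
             * submatrix (sv_diag (dim_row B) (dim_col B) B) {..<k} {..<k}
             * mat_adjoint (submatrix V UNIV {..<k}))"

text \<open>
  A family of norms on all \<open>K_mat K p q\<close> with \<open>p, q \<ge> 1\<close>, given as one function on matrices;
  its values outside these sets are irrelevant.
\<close>

definition matrix_norm_family :: "complex set \<Rightarrow> (complex mat \<Rightarrow> real) \<Rightarrow> bool" where
  "matrix_norm_family K nrm \<longleftrightarrow>
     (\<forall>p \<ge> 1. \<forall>q \<ge> 1. \<forall>B \<in> K_mat K p q.
        nrm B \<ge> 0 \<and>
        (nrm B = 0 \<longleftrightarrow> B = 0\<^sub>m p q) \<and>
        (\<forall>c \<in> K. nrm (c \<cdot>\<^sub>m B) = cmod c * nrm B) \<and>
        (\<forall>D \<in> K_mat K p q. nrm (B + D) \<le> nrm B + nrm D))"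

definition normalized_norm :: "complex set \<Rightarrow> (complex mat \<Rightarrow> real) \<Rightarrow> bool" where
  "normalized_norm K nrm \<longleftrightarrow>
     (\<forall>p \<ge> 1. \<forall>x \<in> K_mat K p 1. nrm x = sqrt (\<Sum>i<p. (cmod (x $$ (i, 0)))\<^sup>2))"

text \<open>
  The symmetric function takes any finite number of arguments, hence is a function on lists that
  is invariant under permutations.
\<close>

definition uniformly_generated :: "complex set \<Rightarrow> (complex mat \<Rightarrow> real) \<Rightarrow> bool" where
  "uniformly_generated K nrm \<longleftrightarrow>
     (\<exists>\<phi> :: real list \<Rightarrow> real.
        (\<forall>xs ys. mset xs = mset ys \<longrightarrow> \<phi> xs = \<phi> ys) \<and>
        (\<forall>p \<ge> 1. \<forall>q \<ge> 1. \<forall>B \<in> K_mat K p q. nrm B = \<phi> (map (\<sigma> B) [1..<mrank B + 1])))"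

definition unitarily_invariant :: "complex set \<Rightarrow> (complex mat \<Rightarrow> real) \<Rightarrow> bool" where
  "unitarily_invariant K nrm \<longleftrightarrow>
     (\<forall>p \<ge> 1. \<forall>q \<ge> 1. \<forall>B \<in> K_mat K p q.
        (\<forall>P. K_unitary K p P \<longrightarrow> nrm (P * B) = nrm B) \<and>
        (\<forall>Q. K_unitary K q Q \<longrightarrow> nrm (B * Q) = nrm B))"

definition submultiplicative_norm :: "complex set \<Rightarrow> (complex mat \<Rightarrow> real) \<Rightarrow> bool" where
  "submultiplicative_norm K nrm \<longleftrightarrow>
     (\<forall>p \<ge> 1. \<forall>q \<ge> 1. \<forall>r \<ge> 1. \<forall>B \<in> K_mat K p q. \<forall>D \<in> K_mat K q r.
        nrm (B * D) \<le> nrm B * nrm D)"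

definition admissible_norm :: "complex set \<Rightarrow> (complex mat \<Rightarrow> real) \<Rightarrow> bool" where
  "admissible_norm K nrm \<longleftrightarrow>
     matrix_norm_family K nrm \<and> normalized_norm K nrm \<and> uniformly_generated K nrm \<and>
     unitarily_invariant K nrm \<and> submultiplicative_norm K nrm"

definition pinv_perturbation_constant ::
  "complex set \<Rightarrow> (complex mat \<Rightarrow> real) \<Rightarrow> real \<Rightarrow> bool" where
  "pinv_perturbation_constant K nrm \<mu> \<longleftrightarrow>
     1 \<le> \<mu> \<and> \<mu> \<le> 3 \<and>
     (\<forall>p \<ge> 1. \<forall>q \<ge> 1. \<forall>B \<in> K_mat K p q. \<forall>B' \<in> K_mat K p q.
        nrm (pinv B - pinv B') \<le>
          (if mrank B = mrank B'
           then \<mu> * spectral_norm (pinv B') * spectral_norm (pinv B) * nrm (B' - B)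
           else \<mu> * max ((spectral_norm (pinv B'))\<^sup>2) ((spectral_norm (pinv B))\<^sup>2) * nrm (B' - B)))"

definition max_volume_rows :: "complex mat \<Rightarrow> nat set \<Rightarrow> bool" where
  "max_volume_rows W I \<longleftrightarrow>
     (\<forall>I' \<subseteq> {..<dim_row W}. card I' = card I \<longrightarrow>
        volume (submatrix W I' UNIV) \<le> volume (submatrix W I UNIV))"

end

theory Submission
  imports
    Defs
    "Jordan_Normal_Form.Spectral_Radius"
    "Jordan_Normal_Form.Matrix_Kernel"
    "HOL-Analysis.L2_Norm"
begin

text \<open>
  The proof compares \<open>A\<close> with its perturbed cross approximation through an exact expansion of the
  error. Writing \<open>W\<^sub>I\<close> and \<open>V\<^sub>J\<close> for the chosen rows of the singular vectors, put \<open>X = W W\<^sub>I\<^sup>-\<^sup>1\<close> and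
  \<open>Y = V V\<^sub>J\<^sup>-\<^sup>1\<close>; the inverses exist because \<open>U = W\<^sub>I S V\<^sub>J\<^sup>H\<close> has rank \<open>k\<close>. Then \<open>C = X U\<close>, \<open>R = U Y\<^sup>H\<close> and \<open>A = X U Y\<^sup>H\<close>. The matrix \<open>X\<close> contains an identity
  block in the rows \<open>I\<close>, and by Cramer's rule its other entries are quotients of two \<open>k \<times> k\<close> minors of
  \<open>W\<close>; as \<open>W\<^sub>I\<close> has maximal volume they have modulus at most 1 (lemma \<open>max_volume_entries\<close>). Hence the
  spectral norm of \<open>X\<close> is at most \<open>t = sqrt (1 + k (n - k))\<close> (lemma \<open>gram_complement\<close>), and likewise for \<open>Y\<close>.

  Let \<open>E\<^sub>I\<close>, \<open>E\<^sub>J\<close>, \<open>E\<^sub>I\<^sub>J\<close> be the submatrices of \<open>E\<close> and \<open>U' = U + E\<^sub>I\<^sub>J\<close>. For vectors the norm is the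
  Euclidean one, so \<open>U'\<close> stretches every vector by at least \<open>s = \<sigma> U k - nrm E\<close>, which exceeds \<open>3 \<epsilon>\<close>
  (lemma \<open>perturbed_singular_value_ge\<close>). In particular \<open>U'\<close> is invertible; being \<open>k \<times> k\<close> it is its own
  truncation of order \<open>k\<close>, and its pseudoinverse is its inverse. Substituting
  \<open>C' = X U' + F\<close> and \<open>R' = U' Y\<^sup>H + G\<close> with \<open>F = E\<^sub>J - X E\<^sub>I\<^sub>J\<close> and \<open>G = E\<^sub>I - E\<^sub>I\<^sub>J Y\<^sup>H\<close> gives
  (lemma \<open>cross_approximation_error\<close>)
    \<open>A - C' U'\<^sup>-\<^sup>1 R' = X E\<^sub>I\<^sub>J Y\<^sup>H - X E\<^sub>I - E\<^sub>J Y\<^sup>H - F U'\<^sup>-\<^sup>1 G\<close>.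
  The linear terms contribute \<open>(2 t + t\<^sup>2) \<epsilon>\<close> and the last one \<open>(1 + t)\<^sup>2 \<epsilon>\<^sup>2 / s \<le> (1 + t)\<^sup>2 \<epsilon> / 3\<close>, and
  \<open>2 t + t\<^sup>2 + (1 + t)\<^sup>2 / 3\<close> is at most \<open>1 / 2 + 3 t + 9 / 2 t\<^sup>2\<close>.

  These estimates need that the norm of \<open>X D\<close> is at most the spectral norm of \<open>X\<close> times the norm
  of \<open>D\<close>, for an arbitrary admissible norm. This is usually derived from a singular value decomposition of \<open>X\<close>; here
  it comes from Gram matrices alone. Rank and singular values of \<open>M\<close> are determined by \<open>M\<^sup>H M\<close>, and
  so is the norm (lemma \<open>nrm_gram_eq\<close>). If \<open>P\<^sup>H P = M\<^sup>H M + N\<^sup>H N\<close>, then \<open>P\<close> has the norm of \<open>M\<close> stacked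
  on \<open>N\<close>, and \<open>M\<close> is recovered from the stack by averaging over a unitary sign change; so the norm of
  \<open>M\<close> is at most that of \<open>P\<close> (lemma \<open>nrm_mono_gram\<close>). To bound \<open>X\<close> by \<open>t\<close> it then suffices to write
  \<open>t\<^sup>2 1 - X\<^sup>H X\<close> as a Gram matrix over \<open>K\<close>, which Lagrange's identity does explicitly.
\<close>

section \<open>Adjoints and Gram matrices\<close>

abbreviation adj :: "complex mat \<Rightarrow> complex mat" ("_\<^sup>H" [1000] 1000) where
  "A\<^sup>H \<equiv> mat_adjoint A"

lemma dim_adj [simp]: "dim_row (A\<^sup>H) = dim_col A" "dim_col (A\<^sup>H) = dim_row A"
  by (simp_all add: mat_adjoint_def)

lemma adj_carrier [simp]: "A \<in> carrier_mat p q \<Longrightarrow> A\<^sup>H \<in> carrier_mat q p"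
  by (intro carrier_matI) auto

lemma adj_index [simp]:
  "i < dim_col A \<Longrightarrow> j < dim_row A \<Longrightarrow> A\<^sup>H $$ (i, j) = cnj (A $$ (j, i))"
  by (simp add: mat_adjoint_def mat_of_rows_def)

lemma adj_adj [simp]: "(A\<^sup>H)\<^sup>H = A"
  by (rule eq_matI) auto

lemma adj_one [simp]: "(1\<^sub>m p)\<^sup>H = 1\<^sub>m p"
  by (rule eq_matI) auto

lemma adj_mult:
  assumes "A \<in> carrier_mat p q" "B \<in> carrier_mat q r"
  shows "(A * B)\<^sup>H = B\<^sup>H * A\<^sup>H"
  by (rule eq_matI, insert assms) (auto simp: scalar_prod_def mult.commute)

lemma gram_carrier [simp]: "A \<in> carrier_mat p q \<Longrightarrow> A\<^sup>H * A \<in> carrier_mat q q"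
  by (intro carrier_matI) auto

lemma adj_minus:
  assumes "A \<in> carrier_mat p q" "B \<in> carrier_mat p q"
  shows "(A - B)\<^sup>H = A\<^sup>H - B\<^sup>H"
  by (rule eq_matI, insert assms) auto

lemma mult_index_sum:
  assumes "A \<in> carrier_mat p q" "B \<in> carrier_mat q r" "i < p" "j < r"
  shows "(A * B) $$ (i, j) = (\<Sum>l<q. A $$ (i, l) * B $$ (l, j))"
  using assms by (auto simp: scalar_prod_def atLeast0LessThan)

lemma gram_index:
  assumes "A \<in> carrier_mat p q" "i < q" "j < q"
  shows "(A\<^sup>H * A) $$ (i, j) = (\<Sum>l<p. cnj (A $$ (l, i)) * A $$ (l, j))"
  using assms by (subst mult_index_sum[of _ q p _ q]) auto

lemma gram_mult:
  assumes "A \<in> carrier_mat p q" "B \<in> carrier_mat q r"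
  shows "(A * B)\<^sup>H * (A * B) = B\<^sup>H * (A\<^sup>H * A) * B"
proof -
  have "(A * B)\<^sup>H * (A * B) = B\<^sup>H * A\<^sup>H * (A * B)"
    using assms by (simp add: adj_mult)
  also have "\<dots> = B\<^sup>H * (A\<^sup>H * (A * B))"
    using assms by (intro assoc_mult_mat[of _ r q _ p _ r]) auto
  also have "A\<^sup>H * (A * B) = A\<^sup>H * A * B"
    using assms by (intro assoc_mult_mat[symmetric, of _ q p _ q _ r]) auto
  also have "B\<^sup>H * (A\<^sup>H * A * B) = B\<^sup>H * (A\<^sup>H * A) * B"
    using assms by (intro assoc_mult_mat[symmetric, of _ r q _ q _ r]) auto
  finally show ?thesis .
qed

lemma gram_mult_isometry:
  assumes "A \<in> carrier_mat p q" "B \<in> carrier_mat q r" "A\<^sup>H * A = 1\<^sub>m q"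
  shows "(A * B)\<^sup>H * (A * B) = B\<^sup>H * B"
  using assms by (simp add: gram_mult right_mult_one_mat[of "B\<^sup>H" r q])

text \<open>The defining property of the adjoint. It makes the quadratic form of a Gram matrix
  \<open>A\<^sup>H A\<close> the squared length of \<open>A x\<close>, which is why the two have the same kernel.\<close>

lemma adj_mult_vec_scalar_prod:
  assumes "A \<in> carrier_mat p q" "x \<in> carrier_vec q" "y \<in> carrier_vec p"
  shows "(A\<^sup>H *\<^sub>v y) \<bullet>c x = y \<bullet>c (A *\<^sub>v x)"
proof -
  have "(A\<^sup>H *\<^sub>v y) \<bullet>c x = (\<Sum>i<q. \<Sum>l<p. cnj (A $$ (l, i)) * y $ l * cnj (x $ i))"
    using assms by (auto simp: scalar_prod_def atLeast0LessThan sum_distrib_right)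
  also have "\<dots> = (\<Sum>l<p. \<Sum>i<q. cnj (A $$ (l, i)) * y $ l * cnj (x $ i))"
    by (rule sum.swap)
  also have "\<dots> = y \<bullet>c (A *\<^sub>v x)"
    using assms by (auto simp: scalar_prod_def atLeast0LessThan sum_distrib_left mult_ac)
  finally show ?thesis .
qed

lemma mat_kernel_gram:
  assumes A: "A \<in> carrier_mat p q"
  shows "mat_kernel (A\<^sup>H * A) = mat_kernel A"
proof
  show "mat_kernel A \<subseteq> mat_kernel (A\<^sup>H * A)"
    using A by (intro mat_kernel_mult_subset[of _ p q _ q]) auto
  show "mat_kernel (A\<^sup>H * A) \<subseteq> mat_kernel A"
  proof
    fix v assume v: "v \<in> mat_kernel (A\<^sup>H * A)"
    have vc: "v \<in> carrier_vec q" and z: "(A\<^sup>H * A) *\<^sub>v v = 0\<^sub>v q"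
      using mat_kernelD[OF gram_carrier[OF A] v] by auto
    have "(A *\<^sub>v v) \<bullet>c (A *\<^sub>v v) = (A\<^sup>H *\<^sub>v (A *\<^sub>v v)) \<bullet>c v"
      using A vc by (intro adj_mult_vec_scalar_prod[symmetric, of _ p q]) auto
    also have "A\<^sup>H *\<^sub>v (A *\<^sub>v v) = (A\<^sup>H * A) *\<^sub>v v"
      using A vc by (intro assoc_mult_mat_vec[symmetric, of _ q p _ q]) auto
    also have "\<dots> \<bullet>c v = 0"
      using z vc by simp
    finally have "A *\<^sub>v v = 0\<^sub>v p"
      using A vc by (subst conjugate_square_eq_0_vec[symmetric, of _ p]) auto
    with A vc show "v \<in> mat_kernel A"
      by (intro mat_kernelI) auto
  qed
qed

section \<open>Rank and characteristic polynomial\<close>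

lemma linear_map_mult_mat_vec:
  fixes A :: "'a :: field mat"
  assumes A: "A \<in> carrier_mat p q"
  shows "linear_map class_ring (module_vec TYPE('a) q) (module_vec TYPE('a) p) ((*\<^sub>v) A)"
proof -
  interpret V: vec_space "TYPE('a)" q .
  interpret W: vec_space "TYPE('a)" p .
  have "(*\<^sub>v) A \<in> LinearCombinations.module_hom class_ring V.V W.V"
    unfolding LinearCombinations.module_hom_def module_vec_simps
    by (intro CollectI conjI ballI allI impI, simp_all only: Pi_iff, insert A)
      (simp_all add: module_vec_simps mult_add_distrib_mat_vec[OF A] mult_mat_vec[OF A])
  then show ?thesis
    by unfold_locales
qed

text \<open>By rank-nullity the rank of a matrix depends only on its kernel and its number of columns, hence
  (with the preceding kernel identity) only on its Gram matrix.\<close>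

lemma mrank_kernel:
  assumes A: "A \<in> carrier_mat p q"
  shows "mrank A + vectorspace.dim class_ring
           (module_vec TYPE(complex) q \<lparr>carrier := mat_kernel A\<rparr>) = q"
proof -
  interpret V: vec_space "TYPE(complex)" q .
  interpret W: vec_space "TYPE(complex)" p .
  interpret T: linear_map class_ring "module_vec TYPE(complex) q" "module_vec TYPE(complex) p" "(*\<^sub>v) A"
    by (rule linear_map_mult_mat_vec[OF A])
  have im: "T.im = W.span (set (cols A))"
    using A W.col_space_eq[OF A] unfolding W.col_space_def T.im_def
    by (auto simp: module_vec_simps)
  have ker: "T.ker = mat_kernel A"
    using A unfolding T.ker_def mat_kernel_def by (auto simp: module_vec_simps)
  have rank: "mrank A = vectorspace.dim class_ring (W.vs (W.span (set (cols A))))"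
    using A by (simp add: mrank_def W.rank_def)
  show ?thesis
    using T.rank_nullity[OF V.fin_dim] unfolding im ker rank by (simp add: V.dim_is_n)
qed

lemma mrank_gram:
  assumes "A \<in> carrier_mat p q"
  shows "mrank (A\<^sup>H * A) = mrank A"
  using mrank_kernel[OF assms] mrank_kernel[of "A\<^sup>H * A" q q] assms
  by (simp add: mat_kernel_gram[OF assms])

lemma mrank_mult_left:
  assumes A: "A \<in> carrier_mat p q" and B: "B \<in> carrier_mat q r"
  shows "mrank (A * B) \<le> mrank A"
proof -
  interpret W: vec_space "TYPE(complex)" p .
  have AB: "A * B \<in> carrier_mat p r" using A B by simp
  have sub: "W.span (set (cols (A * B))) \<subseteq> W.span (set (cols A))"
    using W.col_space_eq[OF A] W.col_space_eq[OF AB] A B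
    unfolding W.col_space_def by (auto simp: assoc_mult_mat_vec[of _ p q _ r])
  have cA: "set (cols A) \<subseteq> carrier_vec p" and cAB: "set (cols (A * B)) \<subseteq> carrier_vec p"
    using A B cols_dim[of A] cols_dim[of "A * B"] by auto
  have sA: "VectorSpace.subspace class_ring (W.span (set (cols A))) W.V"
    using cA by (intro W.span_is_subspace) simp
  have sAB: "VectorSpace.subspace class_ring (W.span (set (cols (A * B)))) W.V"
    using cAB by (intro W.span_is_subspace) simp
  interpret S: vectorspace class_ring "W.vs (W.span (set (cols A)))"
    by (rule W.subspace_is_vs[OF sA])
  have "vectorspace.dim class_ring (W.vs (W.span (set (cols (A * B))))) \<le> S.dim"
    using S.subspace_dim[OF W.nested_subspaces[OF sA sAB sub] W.fin_dim_span_cols[OF A]]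
      W.fin_dim_span_cols[OF AB] by simp
  moreover have "mrank M = vectorspace.dim class_ring (W.vs (W.span (set (cols M))))"
    if "dim_row M = p" for M
    using that by (simp add: mrank_def W.rank_def)
  ultimately show ?thesis
    using A by simp
qed

text \<open>The image of \<open>A\<^sup>H A\<close> lies in the image of \<open>A\<^sup>H\<close>, which gives one inequality; the other is
  the same statement for \<open>A\<^sup>H\<close>.\<close>

lemma mrank_adj:
  assumes "A \<in> carrier_mat p q"
  shows "mrank (A\<^sup>H) = mrank A"
proof -
  have "mrank A \<le> mrank (A\<^sup>H)" if "A \<in> carrier_mat p q" for A p q
    using mrank_mult_left[of "A\<^sup>H" q p A q] that by (simp add: mrank_gram)
  from this[OF assms] this[of "A\<^sup>H" q p] assms show ?thesis by simp
qed

text \<open>The block matrices with rows \<open>(A B, 0)\<close>, \<open>(B, 0)\<close> and \<open>(0, 0)\<close>, \<open>(B, B A)\<close> are similar through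
  the unipotent matrix with rows \<open>(1, A)\<close>, \<open>(0, 1)\<close>. Comparing their characteristic polynomials
  and cancelling that of the zero block gives the claim. It makes the singular values of a square
  matrix and of its adjoint agree.\<close>

lemma char_poly_mult_commute:
  fixes A B :: "complex mat"
  assumes A: "A \<in> carrier_mat n n" and B: "B \<in> carrier_mat n n"
  shows "char_poly (A * B) = char_poly (B * A)"
proof -
  let ?Z = "0\<^sub>m n n :: complex mat" and ?I = "1\<^sub>m n :: complex mat"
  let ?L = "four_block_mat (A * B) ?Z B ?Z" and ?R = "four_block_mat ?Z ?Z B (B * A)"
  let ?P = "four_block_mat ?I A ?Z ?I" and ?Q = "four_block_mat ?I (- A) ?Z ?I"
  have c [simp]: "A * B \<in> carrier_mat n n" "B * A \<in> carrier_mat n n" "- A \<in> carrier_mat n n"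
    using A B by auto
  have neg: "- ?Z = ?Z" "A + - A = ?Z" "- A + A = ?Z"
    by (rule eq_matI; use A in auto)+
  have conj: "A * B * - A = - (A * (B * A))" "B * - A = - (B * A)"
    using A B uminus_mult_right_mat[of "A * B" A] uminus_mult_right_mat[of B A] by auto
  have cancel: "- (A * (B * A)) + A * (B * A) = ?Z" "- (B * A) + B * A = ?Z"
    by (rule eq_matI; use A B in auto)+
  have "similar_mat ?L ?R"
  proof (rule similar_matI[of _ _ ?P ?Q "n + n"])
    show "{?L, ?R, ?P, ?Q} \<subseteq> carrier_mat (n + n) (n + n)"
      using A B by auto
    show "?P * ?Q = 1\<^sub>m (n + n)"
      using A B by (subst mult_four_block_mat[of _ n n _ n _ n _ _ n _ n]) (auto simp: neg intro!: cong_four_block_mat)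
    show "?Q * ?P = 1\<^sub>m (n + n)"
      using A B by (subst mult_four_block_mat[of _ n n _ n _ n _ _ n _ n]) (auto simp: neg intro!: cong_four_block_mat)
    have "?P * ?R = four_block_mat (A * B) (A * (B * A)) B (B * A)"
      using A B by (subst mult_four_block_mat[of _ n n _ n _ n _ _ n _ n]) (auto intro!: cong_four_block_mat)
    also have "\<dots> * ?Q = ?L"
      using A B
      by (subst mult_four_block_mat[of _ n n _ n _ n _ _ n _ n])
        (auto simp: neg conj cancel intro!: cong_four_block_mat)
    finally show "?L = ?P * ?R * ?Q" by simp
  qed
  have fac: "\<exists>es. char_poly M = (\<Prod>a\<leftarrow>es. [:- a, 1:])" if "M \<in> carrier_mat n n" for M :: "complex mat"
    using char_poly_factorized[OF that] by blast
  from \<open>similar_mat ?L ?R\<close> have "char_poly ?L = char_poly ?R" by (rule char_poly_similar)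
  moreover have "char_poly ?L = char_poly (A * B) * char_poly ?Z"
    using A B fac by (intro char_poly_0_block'[of _ _ n n B]) auto
  moreover have "char_poly ?R = char_poly ?Z * char_poly (B * A)"
    using A B fac by (intro char_poly_0_block'[of _ _ n n B]) auto
  moreover have "char_poly ?Z \<noteq> 0"
    using degree_monic_char_poly[of ?Z n] by auto
  ultimately show ?thesis by simp
qed

section \<open>Smallest eigenvalues of Hermitian matrices\<close>

definition vnorm :: "complex vec \<Rightarrow> real" where
  "vnorm v = L2_set (\<lambda>i. cmod (v $ i)) {..<dim_vec v}"

lemma vnorm_nonneg [simp]: "0 \<le> vnorm v"
  by (simp add: vnorm_def)

lemma cscalar_prod_self: "v \<bullet>c v = complex_of_real ((vnorm v)\<^sup>2)"
  by (simp add: vnorm_def L2_set_def sum_nonneg scalar_prod_def atLeast0LessThan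
      flip: complex_norm_square)

lemma cscalar_prod_le:
  assumes "x \<in> carrier_vec n" "y \<in> carrier_vec n"
  shows "cmod (x \<bullet>c y) \<le> vnorm x * vnorm y"
proof -
  have "cmod (x \<bullet>c y) \<le> (\<Sum>i<n. cmod (x $ i * cnj (y $ i)))"
    using assms by (simp add: scalar_prod_def atLeast0LessThan norm_sum)
  also have "\<dots> = (\<Sum>i<n. \<bar>cmod (x $ i)\<bar> * \<bar>cmod (y $ i)\<bar>)"
    by (simp add: norm_mult)
  also have "\<dots> \<le> L2_set (\<lambda>i. cmod (x $ i)) {..<n} * L2_set (\<lambda>i. cmod (y $ i)) {..<n}"
    by (rule L2_set_mult_ineq)
  finally show ?thesis
    using assms by (simp add: vnorm_def)
qed

lemma vnorm_eq_0_iff: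
  assumes "v \<in> carrier_vec n"
  shows "vnorm v = 0 \<longleftrightarrow> v = 0\<^sub>v n"
  using conjugate_square_eq_0_vec[OF assms] by (simp add: cscalar_prod_self)

lemma hermitian_eigenvalue_real:
  assumes H: "H \<in> carrier_mat n n" "H\<^sup>H = H" and z: "poly (char_poly H) z = 0"
  shows "Im z = 0"
proof -
  obtain v where v: "v \<in> carrier_vec n" "v \<noteq> 0\<^sub>v n" "H *\<^sub>v v = z \<cdot>\<^sub>v v"
    using eigenvalue_root_char_poly[OF H(1)] z H(1) by (auto simp: eigenvalue_def eigenvector_def)
  have "z * (v \<bullet>c v) = (H *\<^sub>v v) \<bullet>c v"
    using v by simp
  also have "\<dots> = v \<bullet>c (H *\<^sub>v v)"
    using adj_mult_vec_scalar_prod[OF H(1) v(1) v(1)] H(2) by simp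
  also have "\<dots> = cnj z * (v \<bullet>c v)"
    using v by (simp add: conjugate_smult_vec)
  finally have "z = cnj z"
    using v conjugate_square_eq_0_vec[OF v(1)] by simp
  then show ?thesis
    by (simp add: complex_eq_iff)
qed

text \<open>For Hermitian \<open>H\<close> the numbers \<open>a j\<close>, the lengths of \<open>H\<^sup>j x\<close>, are log-convex by the
  Cauchy-Schwarz inequality. If the first step expanded \<open>x\<close>, every later step would expand by at
  least the same factor, and the powers of \<open>H\<close> would grow geometrically; but they are bounded when
  the spectral radius is below 1. This replaces the diagonalisation of \<open>H\<close>.\<close>

lemma hermitian_contraction:
  assumes H: "H \<in> carrier_mat n n" "H\<^sup>H = H" and r: "spectral_radius H < 1"
    and x: "x \<in> carrier_vec n"
  shows "vnorm (H *\<^sub>v x) \<le> vnorm x"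
proof (rule ccontr)
  assume gt: "\<not> vnorm (H *\<^sub>v x) \<le> vnorm x"
  define y where "y j = (((*\<^sub>v) H) ^^ j) x" for j :: nat
  define a where "a j = vnorm (y j)" for j
  have y_Suc: "y (Suc j) = H *\<^sub>v y j" for j
    by (simp add: y_def)
  have yc: "y j \<in> carrier_vec n" for j
    by (induction j) (use H x in \<open>auto simp: y_Suc\<close>, simp add: y_def)
  have y_pow: "H ^\<^sub>m j *\<^sub>v x = y j" for j
  proof -
    have "H ^\<^sub>m j *\<^sub>v v = (((*\<^sub>v) H) ^^ j) v" if "v \<in> carrier_vec n" for v
      using that
    proof (induction j arbitrary: v)
      case 0
      then show ?case using H by simp
    next
      case (Suc j)
      have "H ^\<^sub>m Suc j *\<^sub>v v = H ^\<^sub>m j *\<^sub>v (H *\<^sub>v v)"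
        using H Suc.prems by (simp add: assoc_mult_mat_vec[of _ n n _ n])
      also have "\<dots> = (((*\<^sub>v) H) ^^ j) (H *\<^sub>v v)"
        using H Suc by simp
      finally show ?case by (simp add: funpow_swap1)
    qed
    then show ?thesis using x by (simp add: y_def)
  qed
  have log_convex: "(a (Suc j))\<^sup>2 \<le> a j * a (Suc (Suc j))" for j
  proof -
    have "complex_of_real ((a (Suc j))\<^sup>2) = (H *\<^sub>v y j) \<bullet>c y (Suc j)"
      by (simp add: a_def cscalar_prod_self flip: y_Suc)
    also have "\<dots> = y j \<bullet>c y (Suc (Suc j))"
      using adj_mult_vec_scalar_prod[OF H(1) yc[of "Suc j"] yc[of j]] H(2) by (simp add: y_Suc)
    finally have "\<bar>(a (Suc j))\<^sup>2\<bar> = cmod (y j \<bullet>c y (Suc (Suc j)))"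
      by (metis norm_of_real)
    then show ?thesis
      using cscalar_prod_le[OF yc yc, of j "Suc (Suc j)"] by (simp add: a_def)
  qed
  have a0: "0 < a 0" and a1: "a 0 < a 1"
  proof -
    show "a 0 < a 1" using gt by (simp add: a_def y_def)
    have "a 0 \<noteq> 0"
    proof
      assume "a 0 = 0"
      then have "x = 0\<^sub>v n" using vnorm_eq_0_iff[OF x] by (simp add: a_def y_def)
      then have "H *\<^sub>v x = x" using H by (intro eq_vecI) auto
      with gt show False by simp
    qed
    then show "0 < a 0" by (simp add: a_def order_less_le)
  qed
  define q where "q = a 1 / a 0"
  have q: "1 < q" using a0 a1 by (simp add: q_def)
  have step: "0 < a j \<and> q * a j \<le> a (Suc j)" for j
  proof (induction j)
    case 0
    then show ?case using a0 by (simp add: q_def)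
  next
    case (Suc j)
    have pos: "0 < a (Suc j)"
      using Suc q by (smt (verit) mult_pos_pos)
    have "(q * a j) * a (Suc j) \<le> a (Suc j) * a (Suc j)"
      using Suc pos by (intro mult_right_mono) auto
    also have "\<dots> \<le> a j * a (Suc (Suc j))"
      using log_convex[of j] by (simp add: power2_eq_square)
    finally have "a j * (q * a (Suc j)) \<le> a j * a (Suc (Suc j))"
      by (simp add: mult_ac)
    then show ?case using Suc pos by simp
  qed
  have grow: "q ^ j * a 0 \<le> a j" for j
  proof (induction j)
    case (Suc j)
    have "q ^ Suc j * a 0 = q * (q ^ j * a 0)" by simp
    also have "\<dots> \<le> q * a j" using Suc q by (intro mult_left_mono) auto
    also have "\<dots> \<le> a (Suc j)" using step by blast
    finally show ?case .
  qed simp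
  obtain b where b: "norm_bound (H ^\<^sub>m j) b" for j
    using spectral_radius_jnf_norm_bound_less_1_upper_triangular[OF H(1) r] by auto
  define M where "M = (\<Sum>i<n. \<Sum>l<n. b * cmod (x $ l))"
  have "a j \<le> M" for j
  proof -
    have "a j \<le> (\<Sum>i<n. cmod (y j $ i))"
      using L2_set_le_sum[of "{..<n}" "\<lambda>i. cmod (y j $ i)"] yc[of j] by (simp add: a_def vnorm_def)
    also have "\<dots> \<le> M"
      unfolding M_def
    proof (rule sum_mono)
      fix i assume i: "i \<in> {..<n}"
      have "y j $ i = (\<Sum>l<n. (H ^\<^sub>m j) $$ (i, l) * x $ l)"
        using i H x by (simp add: scalar_prod_def atLeast0LessThan flip: y_pow)
      also have "cmod \<dots> \<le> (\<Sum>l<n. cmod ((H ^\<^sub>m j) $$ (i, l)) * cmod (x $ l))"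
        by (rule order_trans[OF norm_sum]) (simp add: norm_mult)
      also have "\<dots> \<le> (\<Sum>l<n. b * cmod (x $ l))"
        using b[of j] i H by (intro sum_mono mult_right_mono) (auto simp: norm_bound_def)
      finally show "cmod (y j $ i) \<le> (\<Sum>l<n. b * cmod (x $ l))" .
    qed
    finally show ?thesis .
  qed
  moreover obtain j where "M / a 0 < q ^ j"
    using real_arch_pow[OF q] by blast
  ultimately show False
    using grow[of j] a0 by (smt (verit) divide_less_eq)
qed

lemma smult_mult_mat_vec:
  assumes "A \<in> carrier_mat p q" "v \<in> carrier_vec q"
  shows "(c \<cdot>\<^sub>m A) *\<^sub>v v = c \<cdot>\<^sub>v (A *\<^sub>v v)"
  by (rule eq_vecI, insert assms) (auto simp: scalar_prod_def sum_distrib_left mult_ac)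

text \<open>Rayleigh's principle. The Hermitian matrix \<open>c - H\<close>, with \<open>c\<close> above the spectrum, has its
  spectrum in \<open>[0, c - m]\<close>; divided by \<open>d = c - m + \<delta>\<close> it is a contraction, so its quadratic form is
  at most \<open>d\<close> times the squared length. The slack \<open>\<delta>\<close>, which keeps the spectral radius strictly
  below 1, tends to 0 at the end.\<close>

lemma hermitian_rayleigh:
  assumes H: "H \<in> carrier_mat n n" "H\<^sup>H = H" and n: "0 < n"
    and m: "\<And>z. poly (char_poly H) z = 0 \<Longrightarrow> m \<le> Re z"
    and x: "x \<in> carrier_vec n"
  shows "m * (vnorm x)\<^sup>2 \<le> Re ((H *\<^sub>v x) \<bullet>c x)"
proof -
  define c where "c = max m (spectral_radius H)"
  have upper: "Re z \<le> c" if "poly (char_poly H) z = 0" for z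
  proof -
    have "z \<in> spectrum H" using that spectrum_root_char_poly[OF H(1)] by simp
    then have "cmod z \<le> spectral_radius H"
      using spectral_radius_mem_max(2)[OF H(1) n] by simp
    then show ?thesis
      using complex_Re_le_cmod[of z] by (simp add: c_def)
  qed
  have main: "(m - \<delta>) * (vnorm x)\<^sup>2 \<le> Re ((H *\<^sub>v x) \<bullet>c x)" if \<delta>: "0 < \<delta>" for \<delta>
  proof -
    \<comment> \<open>\<open>\<delta>\<close> also keeps \<open>d\<close> positive when \<open>c = m\<close>.\<close>
    define d where "d = c - m + \<delta>"
    have d: "0 < d" using \<delta> by (simp add: d_def c_def)
    define G where "G = complex_of_real (1 / d) \<cdot>\<^sub>m (complex_of_real c \<cdot>\<^sub>m 1\<^sub>m n - H)"
    have G: "G \<in> carrier_mat n n"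
      unfolding G_def by (intro smult_carrier_mat minus_carrier_mat H(1))
    have H_sym: "cnj (H $$ (j, i)) = H $$ (i, j)" if "i < n" "j < n" for i j
      using H(1) that arg_cong[OF H(2), of "\<lambda>M. M $$ (i, j)"] by simp
    have GH: "G\<^sup>H = G"
      by (rule eq_matI) (use H(1) H_sym in \<open>auto simp: G_def\<close>)
    have Gv: "complex_of_real d \<cdot>\<^sub>v (G *\<^sub>v v) = complex_of_real c \<cdot>\<^sub>v v - H *\<^sub>v v"
      if "v \<in> carrier_vec n" for v
    proof -
      have "complex_of_real d \<cdot>\<^sub>v (G *\<^sub>v v) = (complex_of_real d \<cdot>\<^sub>m G) *\<^sub>v v"
        using G that by (simp add: smult_mult_mat_vec)
      also have "complex_of_real d \<cdot>\<^sub>m G = complex_of_real c \<cdot>\<^sub>m 1\<^sub>m n - H"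
        by (rule eq_matI) (use H(1) d in \<open>auto simp: G_def\<close>)
      also have "\<dots> *\<^sub>v v = complex_of_real c \<cdot>\<^sub>v v - H *\<^sub>v v"
        using H that by (simp add: minus_mult_distrib_mat_vec[of _ n n]
            smult_mult_mat_vec[of _ n n])
      finally show ?thesis .
    qed
    obtain w where w: "w \<in> spectrum G" "spectral_radius G = cmod w"
      using spectral_radius_mem_max(1)[OF G n] by auto
    obtain v where v: "v \<in> carrier_vec n" "v \<noteq> 0\<^sub>v n" "G *\<^sub>v v = w \<cdot>\<^sub>v v"
      using w(1) G by (auto simp: spectrum_def eigenvalue_def eigenvector_def)
    define z where "z = complex_of_real c - complex_of_real d * w"
    have "H *\<^sub>v v = z \<cdot>\<^sub>v v"
    proof (rule eq_vecI)
      fix i assume "i < dim_vec (z \<cdot>\<^sub>v v)"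
      then have i: "i < n" using v by simp
      have "(complex_of_real d \<cdot>\<^sub>v (w \<cdot>\<^sub>v v)) $ i = (complex_of_real c \<cdot>\<^sub>v v - H *\<^sub>v v) $ i"
        using Gv[OF v(1)] v(3) by simp
      then have "complex_of_real d * (w * v $ i) = complex_of_real c * v $ i - (H *\<^sub>v v) $ i"
        using i v H by simp
      then show "(H *\<^sub>v v) $ i = (z \<cdot>\<^sub>v v) $ i"
        using i v by (simp add: z_def algebra_simps)
    qed (use H v in auto)
    then have z: "poly (char_poly H) z = 0"
      using v H eigenvalue_root_char_poly[OF H(1)] by (auto simp: eigenvalue_def eigenvector_def)
    have w_eq: "w = complex_of_real ((c - Re z) / d)"
    proof -
      have "z = complex_of_real (Re z)"
        using hermitian_eigenvalue_real[OF H z] by (simp add: complex_eq_iff)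
      moreover have "w = (complex_of_real c - z) / complex_of_real d"
        using d by (simp add: z_def)
      ultimately show ?thesis
        by (metis of_real_diff of_real_divide)
    qed
    have "cmod w < 1"
      unfolding w_eq norm_of_real using upper[OF z] m[OF z] \<delta> d by (simp add: d_def)
    then have "vnorm (G *\<^sub>v x) \<le> vnorm x"
      using hermitian_contraction[OF G GH _ x] w(2) by simp
    then have "cmod ((G *\<^sub>v x) \<bullet>c x) \<le> vnorm x * vnorm x"
      using cscalar_prod_le[of "G *\<^sub>v x" n x] G x
      by (smt (verit) mult_right_mono mult_mat_vec_carrier vnorm_nonneg)
    then have le: "Re ((G *\<^sub>v x) \<bullet>c x) \<le> (vnorm x)\<^sup>2"
      using complex_Re_le_cmod[of "(G *\<^sub>v x) \<bullet>c x"] by (simp add: power2_eq_square)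
    have "complex_of_real d * ((G *\<^sub>v x) \<bullet>c x) = (complex_of_real d \<cdot>\<^sub>v (G *\<^sub>v x)) \<bullet>c x"
      using G x by simp
    also have "\<dots> = complex_of_real c * (x \<bullet>c x) - (H *\<^sub>v x) \<bullet>c x"
      unfolding Gv[OF x] using H x by (simp add: minus_scalar_prod_distrib[of _ n])
    finally have "complex_of_real d * ((G *\<^sub>v x) \<bullet>c x)
        = complex_of_real (c * (vnorm x)\<^sup>2) - (H *\<^sub>v x) \<bullet>c x"
      by (simp add: cscalar_prod_self)
    from arg_cong[OF this, of Re]
    have "d * Re ((G *\<^sub>v x) \<bullet>c x) = c * (vnorm x)\<^sup>2 - Re ((H *\<^sub>v x) \<bullet>c x)"
      by (simp del: of_real_power of_real_mult)
    moreover have "d * Re ((G *\<^sub>v x) \<bullet>c x) \<le> d * (vnorm x)\<^sup>2"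
      using le d by simp
    ultimately show ?thesis
      by (simp add: d_def algebra_simps)
  qed
  show ?thesis
  proof (rule field_le_epsilon)
    fix e :: real assume e: "0 < e"
    define \<delta> where "\<delta> = e / ((vnorm x)\<^sup>2 + 1)"
    have p: "0 < (vnorm x)\<^sup>2 + 1" by (simp add: add_nonneg_pos)
    then have "0 < \<delta>" using e by (simp add: \<delta>_def)
    from main[OF this] have "m * (vnorm x)\<^sup>2 \<le> Re ((H *\<^sub>v x) \<bullet>c x) + \<delta> * (vnorm x)\<^sup>2"
      by (simp add: algebra_simps)
    also have "\<delta> * (vnorm x)\<^sup>2 \<le> e"
      using e p by (simp add: \<delta>_def divide_le_eq)
    finally show "m * (vnorm x)\<^sup>2 \<le> Re ((H *\<^sub>v x) \<bullet>c x) + e" by simp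
  qed
qed

section \<open>Singular values and volume\<close>

lemma adj_gram: "(A\<^sup>H * A)\<^sup>H = A\<^sup>H * A"
  by (subst adj_mult[of _ "dim_col A" "dim_row A" _ "dim_col A"]) auto

text \<open>Eigenvalues of a Gram matrix are real and nonnegative: for an eigenvector \<open>v\<close> both
  \<open>z \<cdot> v\<^sup>H v\<close> and \<open>v\<^sup>H v\<close> are squared lengths. Hence taking the real part in the definition of the
  singular values loses nothing.\<close>

lemma gram_eigenvalue_nonneg:
  assumes B: "B \<in> carrier_mat p q" and z: "poly (char_poly (B\<^sup>H * B)) z = 0"
  shows "0 \<le> Re z" "z = complex_of_real (Re z)"
proof -
  have H: "B\<^sup>H * B \<in> carrier_mat q q" using B by simp
  show z_real: "z = complex_of_real (Re z)"
    using hermitian_eigenvalue_real[OF H adj_gram z] by (simp add: complex_eq_iff)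
  obtain v where v: "v \<in> carrier_vec q" "v \<noteq> 0\<^sub>v q" "(B\<^sup>H * B) *\<^sub>v v = z \<cdot>\<^sub>v v"
    using eigenvalue_root_char_poly[OF H] z B by (auto simp: eigenvalue_def eigenvector_def)
  have "z * (v \<bullet>c v) = ((B\<^sup>H * B) *\<^sub>v v) \<bullet>c v"
    using v by simp
  also have "(B\<^sup>H * B) *\<^sub>v v = B\<^sup>H *\<^sub>v (B *\<^sub>v v)"
    using B v by (intro assoc_mult_mat_vec[of _ q p _ q]) auto
  also have "\<dots> \<bullet>c v = (B *\<^sub>v v) \<bullet>c (B *\<^sub>v v)"
    using B v by (intro adj_mult_vec_scalar_prod) auto
  finally have "z * complex_of_real ((vnorm v)\<^sup>2) = complex_of_real ((vnorm (B *\<^sub>v v))\<^sup>2)"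
    by (simp only: cscalar_prod_self)
  then have "Re z * (vnorm v)\<^sup>2 = (vnorm (B *\<^sub>v v))\<^sup>2"
    by (metis z_real of_real_eq_iff of_real_mult)
  moreover have "0 < (vnorm v)\<^sup>2"
    using v vnorm_eq_0_iff[OF v(1)] by simp
  ultimately show "0 \<le> Re z"
    by (metis zero_le_mult_iff zero_le_power2 not_less order_less_imp_le order_antisym_conv)
qed

lemma char_poly_nonzero:
  assumes "(A :: complex mat) \<in> carrier_mat n n"
  shows "char_poly A \<noteq> 0"
  using degree_monic_char_poly[OF assms] by auto

lemma mset_singular_values:
  "mset (singular_values B) = image_mset (\<lambda>z. sqrt (Re z)) (proots (char_poly (B\<^sup>H * B)))"
  by (simp add: singular_values_def)

lemma length_singular_values:
  assumes "B \<in> carrier_mat p q"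
  shows "length (singular_values B) = q"
proof -
  have "length (singular_values B) = size (mset (singular_values B))"
    by (rule size_mset[symmetric])
  also have "\<dots> = q"
    unfolding mset_singular_values
    using degree_monic_char_poly[OF gram_carrier[OF assms]] by (simp add: size_proots_complex)
  finally show ?thesis .
qed

lemma smallest_singular_value_le:
  assumes B: "B \<in> carrier_mat p q" and z: "poly (char_poly (B\<^sup>H * B)) z = 0"
  shows "\<sigma> B q \<le> sqrt (Re z)"
proof -
  let ?s = "singular_values B"
  have "sqrt (Re z) \<in> set ?s"
    unfolding set_mset_mset[symmetric] mset_singular_values
    using z char_poly_nonzero[OF gram_carrier[OF B]] by auto
  then obtain i where i: "i < length ?s" "?s ! i = sqrt (Re z)"
    by (auto simp: in_set_conv_nth)
  have "sorted (rev ?s)"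
    by (simp add: singular_values_def)
  then have "?s ! (q - 1) \<le> ?s ! i"
    using i length_singular_values[OF B] sorted_rev_nth_mono[of ?s i "q - 1"] by auto
  then show ?thesis by (simp add: \<sigma>_def i)
qed

text \<open>The last singular value is the smallest one, so its square bounds all eigenvalues of \<open>B\<^sup>H B\<close>
  from below and Rayleigh's principle applies.\<close>

lemma smallest_singular_value_bound:
  assumes B: "B \<in> carrier_mat p q" and q: "0 < q" and nonneg: "0 \<le> \<sigma> B q"
    and x: "x \<in> carrier_vec q"
  shows "\<sigma> B q * vnorm x \<le> vnorm (B *\<^sub>v x)"
proof -
  have "(\<sigma> B q)\<^sup>2 \<le> Re z" if z: "poly (char_poly (B\<^sup>H * B)) z = 0" for z
    using power_mono[OF smallest_singular_value_le[OF B z] nonneg, of 2]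
      gram_eigenvalue_nonneg[OF B z] by simp
  then have "(\<sigma> B q)\<^sup>2 * (vnorm x)\<^sup>2 \<le> Re (((B\<^sup>H * B) *\<^sub>v x) \<bullet>c x)"
    using B q x by (intro hermitian_rayleigh[of _ q]) (auto simp: adj_gram)
  also have "((B\<^sup>H * B) *\<^sub>v x) \<bullet>c x = (B\<^sup>H *\<^sub>v (B *\<^sub>v x)) \<bullet>c x"
    using B x by (simp add: assoc_mult_mat_vec[of _ q p _ q])
  also have "\<dots> = (B *\<^sub>v x) \<bullet>c (B *\<^sub>v x)"
    using B x by (intro adj_mult_vec_scalar_prod) auto
  also have "Re \<dots> = (vnorm (B *\<^sub>v x))\<^sup>2"
    by (simp add: cscalar_prod_self)
  finally show ?thesis
    by (metis power_mono_iff power_mult_distrib vnorm_nonneg nonneg mult_nonneg_nonneg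
        pos2)
qed

lemma det_adj:
  assumes "A \<in> carrier_mat n n"
  shows "det (A\<^sup>H) = cnj (det A)"
proof -
  interpret cnj: comm_ring_hom cnj
    by unfold_locales auto
  have "A\<^sup>H = map_mat cnj (A\<^sup>T)"
    by (rule eq_matI) auto
  then show ?thesis
    using det_transpose[OF assms] by simp
qed

text \<open>A Schur form of \<open>A\<close> is triangular, and its diagonal lists the roots of the characteristic
  polynomial.\<close>

lemma det_eq_prod_proots:
  assumes A: "(A :: complex mat) \<in> carrier_mat n n"
  shows "det A = \<Prod>\<^sub># (proots (char_poly A))"
proof -
  obtain es where es: "char_poly A = (\<Prod>e\<leftarrow>es. [:- e, 1:])"
    using char_poly_factorized[OF A] by auto
  obtain B P Q where B: "schur_decomposition A es = (B, P, Q)"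
    by (cases "schur_decomposition A es")
  have sch: "similar_mat_wit A B P Q" "upper_triangular B" "diag_mat B = es"
    using schur_decomposition[OF A es B] by auto
  have nz: "(\<Prod>e\<leftarrow>es. [:- e, 1:]) \<noteq> 0" for es :: "complex list"
    by (auto simp: prod_list_zero_iff)
  have mset_es: "mset es = proots (\<Prod>e\<leftarrow>es. [:- e, 1:])" for es :: "complex list"
  proof (induction es)
    case (Cons a es)
    have "proots ([:- a, 1:] * (\<Prod>e\<leftarrow>es. [:- e, 1:]))
        = proots [:- a, 1:] + proots (\<Prod>e\<leftarrow>es. [:- e, 1:])"
      by (rule proots_mult[OF _ nz]) simp
    with Cons show ?case by (simp del: mult_pCons_left)
  qed simp
  have "det A = det B"
    using sch(1) by (intro det_similar) (auto simp: similar_mat_def)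
  also have "\<dots> = prod_list es"
    using det_upper_triangular[OF sch(2)] similar_mat_witD2(5)[OF A sch(1)] sch(3) by simp
  also have "\<dots> = \<Prod>\<^sub># (mset es)"
    by (simp add: prod_mset_prod_list)
  also have "mset es = proots (char_poly A)"
    unfolding es by (rule mset_es)
  finally show ?thesis .
qed

text \<open>The product of the squared singular values is \<open>det (B\<^sup>H B)\<close>. Volumes of square submatrices can
  therefore be compared by linear algebra over the field, through Cramer's rule.\<close>

lemma volume_eq_det:
  assumes B: "B \<in> carrier_mat k k"
  shows "volume B = cmod (det B)"
proof -
  let ?Z = "proots (char_poly (B\<^sup>H * B))"
  have real: "0 \<le> Re z" "z = complex_of_real (Re z)" if "z \<in># ?Z" for z
    using gram_eigenvalue_nonneg[OF B, of z] that char_poly_nonzero[OF gram_carrier[OF B]] by auto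
  have of_real_prod: "complex_of_real (\<Prod>z\<in>#Z. Re z) = (\<Prod>z\<in>#Z. complex_of_real (Re z))" for Z
    by (induction Z) auto
  have sqrt_prod: "(\<Prod>z\<in>#Z. sqrt (Re z)) = sqrt (\<Prod>z\<in>#Z. Re z)" for Z
    by (induction Z) (auto simp: real_sqrt_mult)
  have "complex_of_real (\<Prod>z\<in>#?Z. Re z) = (\<Prod>z\<in>#?Z. complex_of_real (Re z))"
    by (rule of_real_prod)
  also have "image_mset (\<lambda>z. complex_of_real (Re z)) ?Z = ?Z"
    using image_mset_cong[of ?Z "\<lambda>z. complex_of_real (Re z)" "\<lambda>z. z"] real(2) by simp
  also have "\<Prod>\<^sub># ?Z = det (B\<^sup>H * B)"
    using det_eq_prod_proots[OF gram_carrier[OF B]] by simp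
  also have "\<dots> = complex_of_real ((cmod (det B))\<^sup>2)"
    using B det_mult[of "B\<^sup>H" k B] det_adj[OF B] complex_norm_square[of "det B"]
    by (simp add: mult.commute)
  finally have prod_Re: "(\<Prod>z\<in>#?Z. Re z) = (cmod (det B))\<^sup>2"
    using of_real_eq_iff by blast
  have "volume B = (\<Prod>i<k. singular_values B ! i)"
    using B unfolding volume_def \<sigma>_def
    by (intro prod.reindex_bij_witness[of _ Suc "\<lambda>i. i - 1"]) auto
  also have "\<dots> = prod_list (singular_values B)"
    using length_singular_values[OF B] by (simp add: prod.list_conv_set_nth atLeast0LessThan)
  also have "\<dots> = (\<Prod>z\<in>#?Z. sqrt (Re z))"
    by (simp add: mset_singular_values flip: prod_mset_prod_list)
  also have "\<dots> = sqrt (\<Prod>z\<in>#?Z. Re z)"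
    by (rule sqrt_prod)
  finally show ?thesis
    using prod_Re by simp
qed

section \<open>Matrices over the scalar field\<close>

text \<open>Both choices of \<open>K\<close> are subfields of the complex numbers that are closed under conjugation and
  contain the reals; all that follows is done uniformly for them.\<close>

locale scalar_field =
  fixes K :: "complex set"
  assumes K: "K = \<real> \<or> K = UNIV"
begin

lemma K_closed [simp, intro]:
  "0 \<in> K" "1 \<in> K" "complex_of_real r \<in> K"
  "x \<in> K \<Longrightarrow> y \<in> K \<Longrightarrow> x + y \<in> K"
  "x \<in> K \<Longrightarrow> y \<in> K \<Longrightarrow> x - y \<in> K"
  "x \<in> K \<Longrightarrow> y \<in> K \<Longrightarrow> x * y \<in> K"
  "x \<in> K \<Longrightarrow> - x \<in> K"
  "x \<in> K \<Longrightarrow> cnj x \<in> K"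
  using K by (auto simp: complex_is_Real_iff)

lemma K_sum: "(\<And>a. a \<in> A \<Longrightarrow> f a \<in> K) \<Longrightarrow> sum f A \<in> K"
  by (induction A rule: infinite_finite_induct) auto

lemma K_mat_iff:
  "B \<in> K_mat K p q \<longleftrightarrow> B \<in> carrier_mat p q \<and> (\<forall>i<p. \<forall>j<q. B $$ (i, j) \<in> K)"
  unfolding K_mat_def by (auto simp: subset_iff)

lemma K_mat_carrier [dest]: "B \<in> K_mat K p q \<Longrightarrow> B \<in> carrier_mat p q"
  by (simp add: K_mat_iff)

lemma K_mat_matI: "(\<And>i j. i < p \<Longrightarrow> j < q \<Longrightarrow> f (i, j) \<in> K) \<Longrightarrow> mat p q f \<in> K_mat K p q"
  by (simp add: K_mat_iff)

lemma K_mat_mult: "A \<in> K_mat K p q \<Longrightarrow> B \<in> K_mat K q r \<Longrightarrow> A * B \<in> K_mat K p r"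
  by (auto simp: K_mat_iff scalar_prod_def intro!: K_sum)

lemma K_mat_add: "A \<in> K_mat K p q \<Longrightarrow> B \<in> K_mat K p q \<Longrightarrow> A + B \<in> K_mat K p q"
  by (auto simp: K_mat_iff)

lemma K_mat_minus: "A \<in> K_mat K p q \<Longrightarrow> B \<in> K_mat K p q \<Longrightarrow> A - B \<in> K_mat K p q"
  by (auto simp: K_mat_iff)

lemma K_mat_uminus: "A \<in> K_mat K p q \<Longrightarrow> - A \<in> K_mat K p q"
  by (auto simp: K_mat_iff)

lemma K_mat_smult: "c \<in> K \<Longrightarrow> A \<in> K_mat K p q \<Longrightarrow> c \<cdot>\<^sub>m A \<in> K_mat K p q"
  by (auto simp: K_mat_iff)

lemma K_mat_adj: "A \<in> K_mat K p q \<Longrightarrow> A\<^sup>H \<in> K_mat K q p"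
  by (auto simp: K_mat_iff)

lemma K_mat_one: "1\<^sub>m p \<in> K_mat K p p"
  by (auto simp: K_mat_iff)

lemma K_mat_zero: "0\<^sub>m p q \<in> K_mat K p q"
  by (auto simp: K_mat_iff)

lemmas K_mat_intros =
  K_mat_mult K_mat_add K_mat_minus K_mat_uminus K_mat_smult K_mat_adj K_mat_one K_mat_zero

end

section \<open>Stacked matrices\<close>

text \<open>Writing one matrix on top of another adds their Gram matrices. So a sum of Gram matrices is again
  a Gram matrix, with entries in the same field.\<close>

definition stack :: "complex mat \<Rightarrow> complex mat \<Rightarrow> complex mat" where
  "stack M N = mat (dim_row M + dim_row N) (dim_col M)
     (\<lambda>(i, j). if i < dim_row M then M $$ (i, j) else N $$ (i - dim_row M, j))"

lemma stack_carrier [simp]: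
  "M \<in> carrier_mat p q \<Longrightarrow> N \<in> carrier_mat p' q \<Longrightarrow> stack M N \<in> carrier_mat (p + p') q"
  by (auto simp: stack_def)

lemma (in scalar_field) K_mat_stack:
  assumes "M \<in> K_mat K p q" "N \<in> K_mat K p' q"
  shows "stack M N \<in> K_mat K (p + p') q"
  using assms by (auto simp: K_mat_iff) (auto simp: stack_def)

lemma sum_lessThan_add:
  fixes f :: "nat \<Rightarrow> 'a :: comm_monoid_add"
  shows "(\<Sum>l<p + p'. f l) = (\<Sum>l<p. f l) + (\<Sum>l<p'. f (p + l))"
  by (induction p') (auto simp: add.assoc)

lemma gram_stack:
  assumes M: "M \<in> carrier_mat p q" and N: "N \<in> carrier_mat p' q"
  shows "(stack M N)\<^sup>H * stack M N = M\<^sup>H * M + N\<^sup>H * N"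
proof (rule eq_matI)
  fix i j assume "i < dim_row (M\<^sup>H * M + N\<^sup>H * N)" "j < dim_col (M\<^sup>H * M + N\<^sup>H * N)"
  then have ij: "i < q" "j < q" using M N by auto
  have "((stack M N)\<^sup>H * stack M N) $$ (i, j)
      = (\<Sum>l<p + p'. cnj (stack M N $$ (l, i)) * stack M N $$ (l, j))"
    by (rule gram_index[OF stack_carrier[OF M N] ij])
  also have "\<dots> = (\<Sum>l<p. cnj (M $$ (l, i)) * M $$ (l, j)) + (\<Sum>l<p'. cnj (N $$ (l, i)) * N $$ (l, j))"
    unfolding sum_lessThan_add using M N ij by (auto simp: stack_def)
  also have "\<dots> = (M\<^sup>H * M + N\<^sup>H * N) $$ (i, j)"
    using M N ij gram_index[OF M ij] gram_index[OF N ij] by (simp del: index_mult_mat(1))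
  finally show "((stack M N)\<^sup>H * stack M N) $$ (i, j) = (M\<^sup>H * M + N\<^sup>H * N) $$ (i, j)" .
qed (use M N in \<open>auto simp: stack_def\<close>)

lemma singular_values_cong:
  "M\<^sup>H * M = N\<^sup>H * N \<Longrightarrow> singular_values M = singular_values N"
  by (simp add: singular_values_def)

lemma \<sigma>_cong: "singular_values M = singular_values N \<Longrightarrow> \<sigma> M = \<sigma> N"
  by (simp add: \<sigma>_def fun_eq_iff)

section \<open>Norm inequalities from Gram matrices\<close>

locale admissible = scalar_field +
  fixes nrm :: "complex mat \<Rightarrow> real"
  assumes nrm: "admissible_norm K nrm"
begin

lemma family: "matrix_norm_family K nrm" and normalized: "normalized_norm K nrm"
  and uniform: "uniformly_generated K nrm" and invariant: "unitarily_invariant K nrm"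
  and submult: "submultiplicative_norm K nrm"
  using nrm by (auto simp: admissible_norm_def)

context
  fixes p q :: nat
  assumes pq: "1 \<le> p" "1 \<le> q"
begin

lemma nrm_nonneg: "B \<in> K_mat K p q \<Longrightarrow> 0 \<le> nrm B"
  using family pq unfolding matrix_norm_family_def by blast

lemma nrm_smult: "B \<in> K_mat K p q \<Longrightarrow> c \<in> K \<Longrightarrow> nrm (c \<cdot>\<^sub>m B) = cmod c * nrm B"
  using family pq unfolding matrix_norm_family_def by blast

lemma nrm_triangle:
  "B \<in> K_mat K p q \<Longrightarrow> D \<in> K_mat K p q \<Longrightarrow> nrm (B + D) \<le> nrm B + nrm D"
  using family pq unfolding matrix_norm_family_def by blast

lemma nrm_uminus: "B \<in> K_mat K p q \<Longrightarrow> nrm (- B) = nrm B"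
proof -
  assume B: "B \<in> K_mat K p q"
  have "- B = (- 1) \<cdot>\<^sub>m B" by (rule eq_matI) auto
  then show ?thesis using nrm_smult[OF B, of "- 1"] by simp
qed

lemma nrm_triangle_minus:
  assumes "B \<in> K_mat K p q" "D \<in> K_mat K p q"
  shows "nrm (B - D) \<le> nrm B + nrm D"
  using nrm_triangle[OF assms(1) K_mat_uminus[OF assms(2)]] nrm_uminus[OF assms(2)] assms
    add_uminus_minus_mat[of B p q D] by (auto simp: K_mat_iff)

lemma nrm_submult:
  "B \<in> K_mat K p q \<Longrightarrow> 1 \<le> r \<Longrightarrow> D \<in> K_mat K q r \<Longrightarrow> nrm (B * D) \<le> nrm B * nrm D"
  using submult pq unfolding submultiplicative_norm_def by blast

lemma nrm_unitary_mult: "B \<in> K_mat K p q \<Longrightarrow> K_unitary K p P \<Longrightarrow> nrm (P * B) = nrm B"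
  using invariant pq unfolding unitarily_invariant_def by blast

end

lemma nrm_eqI:
  assumes "1 \<le> p" "1 \<le> q" "1 \<le> p'" "1 \<le> q'" "M \<in> K_mat K p q" "N \<in> K_mat K p' q'"
    and "singular_values M = singular_values N" "mrank M = mrank N"
  shows "nrm M = nrm N"
proof -
  obtain \<phi> where \<phi>: "\<And>p q B. 1 \<le> p \<Longrightarrow> 1 \<le> q \<Longrightarrow> B \<in> K_mat K p q \<Longrightarrow>
      nrm B = \<phi> (map (\<sigma> B) [1..<mrank B + 1])"
    using uniform unfolding uniformly_generated_def by metis
  show ?thesis
    using \<phi>[OF assms(1,2,5)] \<phi>[OF assms(3,4,6)] \<sigma>_cong[OF assms(7)] assms(8) by simp
qed

text \<open>Singular values and rank are functions of the Gram matrix, so a uniformly generated norm is too,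
  even for matrices with different numbers of rows. All comparisons of norms below go through this
  fact.\<close>

lemma nrm_gram_eq:
  assumes "1 \<le> p" "1 \<le> p'" "1 \<le> q" and M: "M \<in> K_mat K p q" and N: "N \<in> K_mat K p' q"
    and eq: "M\<^sup>H * M = N\<^sup>H * N"
  shows "nrm M = nrm N"
proof (rule nrm_eqI[OF assms(1,3,2,3) M N])
  show "singular_values M = singular_values N"
    by (rule singular_values_cong[OF eq])
  show "mrank M = mrank N"
    using mrank_gram[OF K_mat_carrier[OF M]] mrank_gram[OF K_mat_carrier[OF N]] eq by simp
qed

lemma nrm_adj:
  assumes n: "1 \<le> n" and M: "M \<in> K_mat K n n"
  shows "nrm (M\<^sup>H) = nrm M"
proof (rule nrm_eqI[OF n n n n K_mat_adj[OF M] M])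
  show "singular_values (M\<^sup>H) = singular_values M"
    using char_poly_mult_commute[of M n "M\<^sup>H"] M by (auto simp: singular_values_def)
  show "mrank (M\<^sup>H) = mrank M"
    using M by (intro mrank_adj) auto
qed

text \<open>The matrix \<open>D = diag(1,\<dots>,1,-1,\<dots>,-1)\<close> is unitary over \<open>K\<close>, and averaging \<open>stack M N\<close> with its
  reflection \<open>D * stack M N\<close> erases the lower block.\<close>

lemma nrm_le_nrm_stack:
  assumes p: "1 \<le> p" and q: "1 \<le> q" and M: "M \<in> K_mat K p q" and N: "N \<in> K_mat K p' q"
  shows "nrm M \<le> nrm (stack M N)"
proof -
  let ?r = "p + p'" and ?Z = "0\<^sub>m p' q :: complex mat"
  have r: "1 \<le> ?r" using p by simp
  have Mc: "M \<in> carrier_mat p q" and Nc: "N \<in> carrier_mat p' q" using M N by auto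
  define D where "D = mat ?r ?r (\<lambda>(i, j). if i = j then if i < p then 1 else - 1 else 0 :: complex)"
  have Dc: "D \<in> carrier_mat ?r ?r" by (simp add: D_def)
  have DH: "D\<^sup>H = D" by (rule eq_matI) (auto simp: D_def)
  have D_mult: "D * B = mat ?r c (\<lambda>(i, j). (if i < p then 1 else - 1) * B $$ (i, j))"
    if B: "B \<in> carrier_mat ?r c" for B c
  proof (rule eq_matI)
    fix i j assume "i < dim_row (mat ?r c (\<lambda>(i, j). (if i < p then 1 else - 1) * B $$ (i, j)))"
      "j < dim_col (mat ?r c (\<lambda>(i, j). (if i < p then 1 else - 1) * B $$ (i, j)))"
    then have ij: "i < ?r" "j < c" by auto
    have "(D * B) $$ (i, j) = (\<Sum>l<?r. D $$ (i, l) * B $$ (l, j))"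
      by (rule mult_index_sum[OF Dc B ij])
    also have "\<dots> = (\<Sum>l<?r. if l = i then (if i < p then 1 else - 1) * B $$ (i, j) else 0)"
      using ij by (intro sum.cong) (auto simp: D_def)
    also have "\<dots> = (if i < p then 1 else - 1) * B $$ (i, j)"
      using ij by simp
    finally show "(D * B) $$ (i, j)
        = mat ?r c (\<lambda>(i, j). (if i < p then 1 else - 1) * B $$ (i, j)) $$ (i, j)"
      using ij by simp
  qed (use B in \<open>auto simp: D_def\<close>)
  have "D * D = 1\<^sub>m ?r"
    unfolding D_mult[OF Dc] by (rule eq_matI) (auto simp: D_def)
  moreover have DK: "D \<in> K_mat K ?r ?r"
    by (auto simp: D_def intro!: K_mat_matI)
  ultimately have D: "K_unitary K ?r D"
    by (simp add: K_unitary_def DH)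
  have S: "stack M N \<in> K_mat K ?r q" and S0: "stack M ?Z \<in> K_mat K ?r q"
    using M N by (auto intro!: K_mat_stack K_mat_zero)
  have "2 \<cdot>\<^sub>m stack M ?Z = stack M N + D * stack M N"
    unfolding D_mult[OF stack_carrier[OF Mc Nc]]
    by (rule eq_matI) (use Mc Nc in \<open>auto simp: stack_def\<close>)
  moreover have "nrm (stack M N + D * stack M N) \<le> nrm (stack M N) + nrm (D * stack M N)"
    by (rule nrm_triangle[OF r q S K_mat_mult[OF DK S]])
  moreover have "nrm (D * stack M N) = nrm (stack M N)"
    by (rule nrm_unitary_mult[OF r q S D])
  moreover have "nrm (2 \<cdot>\<^sub>m stack M ?Z) = 2 * nrm (stack M ?Z)"
    using nrm_smult[OF r q S0, of 2] K by auto
  moreover have "nrm (stack M ?Z) = nrm M"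
  proof (rule nrm_gram_eq[OF r p q S0 M])
    have "?Z\<^sup>H * ?Z = 0\<^sub>m q q"
      by (rule eq_matI) (auto simp: scalar_prod_def)
    then show "(stack M ?Z)\<^sup>H * stack M ?Z = M\<^sup>H * M"
      using gram_stack[OF Mc, of ?Z p'] right_add_zero_mat[OF gram_carrier[OF Mc]] by simp
  qed
  ultimately show ?thesis by simp
qed

lemma nrm_mono_gram:
  assumes "1 \<le> p" "1 \<le> r" "1 \<le> q"
    and M: "M \<in> K_mat K p q" and N: "N \<in> K_mat K p' q" and P: "P \<in> K_mat K r q"
    and eq: "P\<^sup>H * P = M\<^sup>H * M + N\<^sup>H * N"
  shows "nrm M \<le> nrm P"
proof -
  have "nrm M \<le> nrm (stack M N)"
    by (rule nrm_le_nrm_stack[OF assms(1,3) M N])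
  also have "\<dots> = nrm P"
    using assms gram_stack[of M p q N p']
    by (intro nrm_gram_eq[OF _ _ _ K_mat_stack[OF M N] P]) auto
  finally show ?thesis .
qed

text \<open>The inequality between Gram matrices that drives everything: if \<open>P\<^sup>H P\<close> exceeds \<open>M\<^sup>H M\<close> by a
  Gram matrix, then \<open>M D\<close> is at most as large as \<open>P D\<close> for every \<open>D\<close>.\<close>

lemma nrm_mult_mono:
  assumes "1 \<le> p" "1 \<le> r" "1 \<le> s"
    and M: "M \<in> K_mat K p q" and N: "N \<in> K_mat K p' q" and P: "P \<in> K_mat K r q"
    and D: "D \<in> K_mat K q s"
    and eq: "P\<^sup>H * P = M\<^sup>H * M + N\<^sup>H * N"
  shows "nrm (M * D) \<le> nrm (P * D)"
proof (rule nrm_mono_gram[OF assms(1-3) K_mat_mult[OF M D] K_mat_mult[OF N D] K_mat_mult[OF P D]])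
  have c: "M \<in> carrier_mat p q" "N \<in> carrier_mat p' q" "P \<in> carrier_mat r q" "D \<in> carrier_mat q s"
    using M N P D by auto
  have "(P * D)\<^sup>H * (P * D) = D\<^sup>H * (M\<^sup>H * M + N\<^sup>H * N) * D"
    using gram_mult[OF c(3,4)] eq by simp
  also have "\<dots> = (D\<^sup>H * (M\<^sup>H * M) + D\<^sup>H * (N\<^sup>H * N)) * D"
    using c by (subst mult_add_distrib_mat[of _ s q _ q]) auto
  also have "\<dots> = D\<^sup>H * (M\<^sup>H * M) * D + D\<^sup>H * (N\<^sup>H * N) * D"
    using c by (intro add_mult_distrib_mat[of _ s q]) (auto intro!: mult_carrier_mat[of _ s q])
  finally show "(P * D)\<^sup>H * (P * D) = (M * D)\<^sup>H * (M * D) + (N * D)\<^sup>H * (N * D)"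
    using gram_mult[OF c(1,4)] gram_mult[OF c(2,4)] by simp
qed

lemma gram_scalar:
  "(complex_of_real c \<cdot>\<^sub>m 1\<^sub>m q)\<^sup>H * (complex_of_real c \<cdot>\<^sub>m 1\<^sub>m q) = complex_of_real (c\<^sup>2) \<cdot>\<^sub>m 1\<^sub>m q"
proof -
  have "(complex_of_real c \<cdot>\<^sub>m 1\<^sub>m q)\<^sup>H = complex_of_real c \<cdot>\<^sub>m 1\<^sub>m q"
    by (rule eq_matI) auto
  then show ?thesis
    by (simp add: mult_smult_assoc_mat[of _ q q] power2_eq_square) (rule eq_matI; auto)
qed

text \<open>With \<open>P\<close> a multiple of the identity this bounds \<open>X D\<close> by the spectral norm of \<open>X\<close> times the
  norm of \<open>D\<close>. The spectral bound enters as an explicit complement \<open>N\<close>, whose entries must lie in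
  \<open>K\<close>.\<close>

lemma nrm_mult_le:
  assumes "1 \<le> p" "1 \<le> q" "1 \<le> s" "0 \<le> c"
    and X: "X \<in> K_mat K p q" and N: "N \<in> K_mat K p' q" and D: "D \<in> K_mat K q s"
    and eq: "X\<^sup>H * X + N\<^sup>H * N = complex_of_real (c\<^sup>2) \<cdot>\<^sub>m 1\<^sub>m q"
  shows "nrm (X * D) \<le> c * nrm D"
proof -
  have Dc: "D \<in> carrier_mat q s" using D by auto
  have "nrm (X * D) \<le> nrm ((complex_of_real c \<cdot>\<^sub>m 1\<^sub>m q) * D)"
    using assms by (intro nrm_mult_mono[OF assms(1,2,3) X N _ D])
      (auto simp: gram_scalar intro!: K_mat_intros)
  also have "(complex_of_real c \<cdot>\<^sub>m 1\<^sub>m q) * D = complex_of_real c \<cdot>\<^sub>m D"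
    using Dc by (simp add: mult_smult_assoc_mat[of _ q q])
  also have "nrm \<dots> = c * nrm D"
    using nrm_smult[OF assms(2,3) D, of "complex_of_real c"] assms(4) by simp
  finally show ?thesis .
qed

lemma nrm_mult_ge:
  assumes "1 \<le> p" "1 \<le> q" "1 \<le> s" "0 \<le> c"
    and X: "X \<in> K_mat K p q" and N: "N \<in> K_mat K p' q" and D: "D \<in> K_mat K q s"
    and eq: "X\<^sup>H * X = complex_of_real (c\<^sup>2) \<cdot>\<^sub>m 1\<^sub>m q + N\<^sup>H * N"
  shows "c * nrm D \<le> nrm (X * D)"
proof -
  have Dc: "D \<in> carrier_mat q s" using D by auto
  have "c * nrm D = nrm (complex_of_real c \<cdot>\<^sub>m D)"
    using nrm_smult[OF assms(2,3) D, of "complex_of_real c"] assms(4) by simp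
  also have "complex_of_real c \<cdot>\<^sub>m D = (complex_of_real c \<cdot>\<^sub>m 1\<^sub>m q) * D"
    using Dc by (simp add: mult_smult_assoc_mat[of _ q q])
  also have "nrm \<dots> \<le> nrm (X * D)"
    using assms by (intro nrm_mult_mono[OF assms(2,1,3) _ N X D])
      (auto simp: gram_scalar intro!: K_mat_intros)
  finally show ?thesis .
qed

lemma nrm_isometry_mult:
  assumes "1 \<le> p" "1 \<le> q" "1 \<le> s" and S: "S \<in> K_mat K p q" and D: "D \<in> K_mat K q s"
    and iso: "S\<^sup>H * S = 1\<^sub>m q"
  shows "nrm (S * D) = nrm D"
  using gram_mult_isometry[of S p q D s] S D iso
  by (intro nrm_gram_eq[OF assms(1-3) K_mat_mult[OF S D] D]) auto

text \<open>The complement of the projection \<open>S S\<^sup>H\<close> is a projection as well, hence its own Gram matrix. For a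
  selector \<open>S\<close> of rows the lemma says that passing to a set of rows does not increase the norm.\<close>

lemma nrm_coisometry_mult:
  assumes "1 \<le> p" "1 \<le> q" "1 \<le> s" and S: "S \<in> K_mat K p q" and D: "D \<in> K_mat K p s"
    and iso: "S\<^sup>H * S = 1\<^sub>m q"
  shows "nrm (S\<^sup>H * D) \<le> nrm D"
proof -
  have Sc: "S \<in> carrier_mat p q" using S by auto
  define P where "P = S * S\<^sup>H"
  define N where "N = 1\<^sub>m p - P"
  have Pc: "P \<in> carrier_mat p p" using Sc by (auto simp: P_def)
  have Nc: "N \<in> carrier_mat p p" using Pc by (auto simp: N_def)
  have PH: "P\<^sup>H = P"
    using Sc by (simp add: P_def adj_mult[of _ p q _ p])
  have PP: "P * P = P"
  proof -
    have "P * P = S * (S\<^sup>H * (S * S\<^sup>H))"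
      using Sc unfolding P_def by (intro assoc_mult_mat[of _ p q _ p _ p]) auto
    also have "S\<^sup>H * (S * S\<^sup>H) = (S\<^sup>H * S) * S\<^sup>H"
      using Sc by (intro assoc_mult_mat[symmetric, of _ q p _ q _ p]) auto
    finally show ?thesis using Sc iso by (simp add: P_def)
  qed
  have NH: "N\<^sup>H = N"
    using Pc by (simp add: N_def adj_minus[of _ p p] PH)
  have NN: "N\<^sup>H * N = N"
  proof -
    have "N * N = (1\<^sub>m p - P) * N"
      by (subst N_def) (rule refl)
    also have "\<dots> = N - P * N"
      using Pc Nc by (simp add: minus_mult_distrib_mat[of _ p p])
    also have "P * N = P - P * P"
      using Pc unfolding N_def by (subst mult_minus_distrib_mat[of _ p p _ p]) auto
    finally show ?thesis
      using PP Pc Nc NH by (intro eq_matI) auto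
  qed
  have "nrm (S\<^sup>H * D) \<le> nrm (1\<^sub>m p * D)"
  proof (rule nrm_mult_mono[OF assms(2,1,3) K_mat_adj[OF S] _ K_mat_one D])
    show "N \<in> K_mat K p p"
      using S by (auto simp: N_def P_def intro!: K_mat_intros)
    have "(S\<^sup>H)\<^sup>H * S\<^sup>H + N\<^sup>H * N = P + N"
      using NN by (simp add: P_def)
    also have "\<dots> = 1\<^sub>m p"
      using Pc by (intro eq_matI) (auto simp: N_def)
    finally show "(1\<^sub>m p)\<^sup>H * 1\<^sub>m p = (S\<^sup>H)\<^sup>H * S\<^sup>H + N\<^sup>H * N"
      by simp
  qed
  then show ?thesis using D by (auto simp: K_mat_iff)
qed

lemma nrm_vec:
  assumes "1 \<le> p" "x \<in> K_mat K p 1"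
  shows "nrm x = vnorm (col x 0)"
proof -
  have "nrm x = sqrt (\<Sum>i<p. (cmod (x $$ (i, 0)))\<^sup>2)"
    using normalized assms unfolding normalized_norm_def by blast
  then show ?thesis
    using assms by (auto simp: vnorm_def L2_set_def K_mat_iff)
qed

end

section \<open>Selecting rows and columns\<close>

text \<open>The columns of \<open>selector n I\<close> are the unit vectors \<open>e\<^sub>i\<close>, \<open>i \<in> I\<close>, in increasing order, so that
  submatrices become products: multiplying by its adjoint from the left selects rows, multiplying
  by it from the right selects columns.\<close>

definition selector :: "nat \<Rightarrow> nat set \<Rightarrow> complex mat" where
  "selector n I = mat n (card I) (\<lambda>(i, a). if i = pick I a then 1 else 0)"

lemma selector_carrier [simp]: "selector n I \<in> carrier_mat n (card I)"
  by (simp add: selector_def)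

lemma dim_selector [simp]: "dim_row (selector n I) = n" "dim_col (selector n I) = card I"
  by (simp_all add: selector_def)

lemma bij_betw_pick:
  assumes "finite I"
  shows "bij_betw (pick I) {..<card I} I"
proof (rule bij_betwI')
  fix a b assume "a \<in> {..<card I}" "b \<in> {..<card I}"
  then show "pick I a = pick I b \<longleftrightarrow> a = b"
    by (metis card_pick_le lessThan_iff)
next
  fix a assume "a \<in> {..<card I}"
  then show "pick I a \<in> I" by (simp add: pick_in_set_le)
next
  fix i assume i: "i \<in> I"
  have "card {a \<in> I. a < i} < card I"
    using assms i by (intro psubset_card_mono) auto
  then show "\<exists>a\<in>{..<card I}. i = pick I a"
    using pick_card_in_set[OF i] by (metis lessThan_iff)
qed

context
  fixes n :: nat and I :: "nat set"
  assumes I: "I \<subseteq> {..<n}"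
begin

lemma finite_index: "finite I"
  using I finite_subset by blast

lemma pick_less: "a < card I \<Longrightarrow> pick I a < n"
  using I pick_in_set_le[of a I] by auto

lemma pick_eq_iff: "a < card I \<Longrightarrow> b < card I \<Longrightarrow> pick I a = pick I b \<longleftrightarrow> a = b"
  using bij_betw_pick[OF finite_index] by (auto simp: bij_betw_def inj_on_def)

lemma card_index: "card {i. i < n \<and> i \<in> I} = card I"
  using I by (intro arg_cong[of _ _ card]) auto

lemma selector_gram: "(selector n I)\<^sup>H * selector n I = 1\<^sub>m (card I)"
proof (rule eq_matI)
  fix a b assume "a < dim_row (1\<^sub>m (card I))" "b < dim_col (1\<^sub>m (card I))"
  then have ab: "a < card I" "b < card I" by auto
  have "((selector n I)\<^sup>H * selector n I) $$ (a, b) = (\<Sum>i<n. if i = pick I a then if a = b then 1 else 0 else 0)"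
    unfolding gram_index[OF selector_carrier ab]
    using ab by (intro sum.cong) (auto simp: selector_def pick_eq_iff)
  then show "((selector n I)\<^sup>H * selector n I) $$ (a, b) = 1\<^sub>m (card I) $$ (a, b)"
    using ab pick_less by (simp del: index_mult_mat(1))
qed (auto simp: selector_def)

lemma selector_adj_mult_index:
  assumes B: "B \<in> carrier_mat n q" and a: "a < card I" and j: "j < q"
  shows "((selector n I)\<^sup>H * B) $$ (a, j) = B $$ (pick I a, j)"
proof -
  have "((selector n I)\<^sup>H * B) $$ (a, j) = (\<Sum>i<n. if i = pick I a then B $$ (i, j) else 0)"
    unfolding mult_index_sum[OF adj_carrier[OF selector_carrier] B a j]
    using a by (intro sum.cong) (auto simp: selector_def)
  then show ?thesis using a pick_less by simp
qed

lemma submatrix_rows: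
  assumes B: "B \<in> carrier_mat n q"
  shows "submatrix B I UNIV = (selector n I)\<^sup>H * B"
  by (rule eq_matI)
    (use B selector_adj_mult_index[OF B] in
      \<open>auto simp: submatrix_def pick_UNIV card_index selector_def simp del: index_mult_mat(1)\<close>)

lemma submatrix_cols:
  assumes B: "B \<in> carrier_mat p n"
  shows "submatrix B UNIV I = B * selector n I"
proof (rule eq_matI)
  fix i a assume "i < dim_row (B * selector n I)" "a < dim_col (B * selector n I)"
  then have ia: "i < p" "a < card I" using B by (auto simp: selector_def)
  have "(B * selector n I) $$ (i, a) = (\<Sum>l<n. if l = pick I a then B $$ (i, l) else 0)"
    unfolding mult_index_sum[OF B selector_carrier ia]
    using ia by (intro sum.cong) (auto simp: selector_def)
  then show "submatrix B UNIV I $$ (i, a) = (B * selector n I) $$ (i, a)"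
    using ia pick_less B by (simp add: submatrix_def pick_UNIV card_index del: index_mult_mat(1))
qed (use B in \<open>auto simp: submatrix_def card_index selector_def\<close>)

end

lemma submatrix_both:
  assumes "B \<in> carrier_mat n m" "I \<subseteq> {..<n}" "J \<subseteq> {..<m}"
  shows "submatrix B I J = (selector n I)\<^sup>H * (B * selector m J)"
proof -
  have "B * selector m J \<in> carrier_mat n (card J)"
    using assms by simp
  then show ?thesis
    using submatrix_split[of B I J] submatrix_cols[OF assms(3,1)] submatrix_rows[OF assms(2)] by simp
qed

lemma (in scalar_field) selector_K_mat: "selector n I \<in> K_mat K n (card I)"
  unfolding selector_def by (rule K_mat_matI) auto

section \<open>Submatrices of maximal volume\<close>

text \<open>For real matrices the entrywise conjugate of the inverse is again an inverse, hence equal to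
  it.\<close>

lemma (in scalar_field) K_inverse_exists:
  assumes B: "B \<in> K_mat K k k" and det: "det B \<noteq> 0"
  shows "\<exists>Z \<in> K_mat K k k. B * Z = 1\<^sub>m k \<and> Z * B = 1\<^sub>m k"
proof -
  have Bc: "B \<in> carrier_mat k k" using B by auto
  define Z where "Z = inverse (det B) \<cdot>\<^sub>m adj_mat B"
  have Zc: "Z \<in> carrier_mat k k"
    using adj_mat(1)[OF Bc] by (simp add: Z_def)
  have BZ: "B * Z = 1\<^sub>m k"
  proof -
    have "B * Z = inverse (det B) \<cdot>\<^sub>m (det B \<cdot>\<^sub>m 1\<^sub>m k)"
      using adj_mat(1,2)[OF Bc] Bc by (simp add: Z_def mult_smult_distrib[of _ k k])
    then show ?thesis using det by (intro eq_matI) auto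
  qed
  have ZB: "Z * B = 1\<^sub>m k"
    by (rule mat_mult_left_right_inverse[OF Bc Zc BZ])
  have "Z \<in> K_mat K k k"
    using K
  proof
    assume KR: "K = \<real>"
    interpret cnj: comm_ring_hom cnj
      by unfold_locales auto
    let ?Z = "map_mat cnj Z"
    have "B $$ (i, j) \<in> \<real>" if "i < k" "j < k" for i j
      using B[unfolded K_mat_iff] KR that by blast
    then have "map_mat cnj B = B"
      using Bc by (intro eq_matI) (auto simp: Reals_cnj_iff)
    then have "B * ?Z = map_mat cnj (B * Z)"
      using cnj.mat_hom_mult[OF Bc Zc] by simp
    also have "\<dots> = 1\<^sub>m k"
      unfolding BZ by (rule eq_matI) auto
    finally have "Z * (B * ?Z) = Z"
      using Zc by simp
    moreover have "Z * (B * ?Z) = Z * B * ?Z"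
      using Bc Zc by (intro assoc_mult_mat[symmetric, of _ k k _ k _ k]) auto
    moreover have "\<dots> = ?Z"
      using Zc by (simp add: ZB)
    ultimately have real: "?Z = Z" by simp
    have "Z $$ (i, j) \<in> K" if "i < k" "j < k" for i j
    proof -
      have "cnj (Z $$ (i, j)) = Z $$ (i, j)"
        using arg_cong[OF real, of "\<lambda>M. M $$ (i, j)"] Zc that by simp
      then show ?thesis using KR by (simp add: Reals_cnj_iff)
    qed
    then show ?thesis using Zc by (auto simp: K_mat_iff)
  next
    assume "K = UNIV"
    then show ?thesis using Zc unfolding K_mat_iff by simp
  qed
  with BZ ZB show ?thesis by blast
qed

text \<open>Two enumerations of the same set of rows differ by a permutation, which changes the determinant
  only by a sign. Exchanging a row of a submatrix can thus be described by any convenient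
  enumeration rather than the increasing one.\<close>

lemma cmod_det_reindex_rows:
  fixes B :: "complex mat" and f g :: "nat \<Rightarrow> nat"
  assumes f: "bij_betw f {..<k} I" and g: "bij_betw g {..<k} I"
  shows "cmod (det (mat k k (\<lambda>(a, b). B $$ (f a, b)))) = cmod (det (mat k k (\<lambda>(a, b). B $$ (g a, b))))"
proof -
  define p where "p a = (if a < k then inv_into {..<k} g (f a) else a)" for a
  have "bij_betw (inv_into {..<k} g \<circ> f) {..<k} {..<k}"
    by (rule bij_betw_trans[OF f bij_betw_inv_into[OF g]])
  then have "bij_betw p {..<k} {..<k}"
    by (rule bij_betw_cong[THEN iffD1, rotated]) (simp add: p_def)
  then have p: "p permutes {0..<k}"
    by (intro bij_imp_permutes) (auto simp: p_def atLeast0LessThan)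
  have p_less: "p a < k" and gp: "g (p a) = f a" if "a < k" for a
    using that \<open>bij_betw p {..<k} {..<k}\<close> bij_betw_inv_into_right[OF g, of "f a"] f
    by (auto simp: bij_betw_def p_def)
  let ?G = "mat k k (\<lambda>(a, b). B $$ (g a, b))"
  have "mat k k (\<lambda>(a, b). B $$ (f a, b)) = mat k k (\<lambda>(a, b). ?G $$ (p a, b))"
    by (rule eq_matI) (auto simp: p_less gp)
  then have "det (mat k k (\<lambda>(a, b). B $$ (f a, b))) = signof p * det ?G"
    using det_permute_rows[OF _ p, of ?G] by simp
  then show ?thesis
    by (cases p rule: sign_cases) (auto simp: norm_mult)
qed

lemma transpose_mult_vec_index:
  fixes M :: "complex mat"
  assumes "M \<in> carrier_mat p q" "x \<in> carrier_vec p" "b < q"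
  shows "(M\<^sup>T *\<^sub>v x) $ b = (\<Sum>l<p. x $ l * M $$ (l, b))"
  using assms by (auto simp: scalar_prod_def atLeast0LessThan mult.commute)

text \<open>Write \<open>W\<^sub>I\<close> for the submatrix of the rows in \<open>I\<close> and \<open>X = W Z\<close>, so \<open>W = X W\<^sub>I\<close>. For \<open>i \<in> I\<close> the
  \<open>i\<close>-th row of \<open>X\<close> is a unit vector. For \<open>i \<notin> I\<close>, replacing the \<open>j\<close>-th row of \<open>W\<^sub>I\<close> by the \<open>i\<close>-th
  row of \<open>W\<close> multiplies the determinant by \<open>X\<^sub>i\<^sub>j\<close> (Cramer's rule, applied to the transposed
  matrix). The new matrix has the rows of another set of \<open>k\<close> indices, so maximality of the volume
  forbids \<open>\<bar>X\<^sub>i\<^sub>j\<bar> > 1\<close>.\<close>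

lemma max_volume_entries:
  assumes W: "W \<in> carrier_mat n k" and I: "I \<subseteq> {..<n}" "card I = k"
    and max: "max_volume_rows W I"
    and Z: "Z \<in> carrier_mat k k" and inv: "((selector n I)\<^sup>H * W) * Z = 1\<^sub>m k"
    and ij: "i < n" "j < k"
  shows "cmod ((W * Z) $$ (i, j)) \<le> 1"
proof -
  let ?WI = "(selector n I)\<^sup>H * W" and ?X = "W * Z"
  have S: "(selector n I)\<^sup>H \<in> carrier_mat k n"
    using adj_carrier[OF selector_carrier, of n I] I(2) by simp
  have WI: "?WI \<in> carrier_mat k k" using S W by simp
  have X: "?X \<in> carrier_mat n k" using W Z by simp
  have rows: "?WI $$ (a, b) = W $$ (pick I a, b)" if "a < k" "b < k" for a b
    using selector_adj_mult_index[OF I(1) W, of a b] I(2) that by simp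
  show ?thesis
  proof (cases "i \<in> I")
    case True
    then obtain a where a: "a < k" "i = pick I a"
      using bij_betw_pick[OF finite_index[OF I(1)]] I(2) by (auto simp: bij_betw_def)
    have "?X $$ (i, j) = ((selector n I)\<^sup>H * ?X) $$ (a, j)"
      using selector_adj_mult_index[OF I(1) X, of a j] a ij I(2) by simp
    also have "(selector n I)\<^sup>H * ?X = 1\<^sub>m k"
      using assoc_mult_mat[OF S W Z] inv by simp
    finally show ?thesis using a ij by simp
  next
    case False
    define f where "f a = (if a = j then i else pick I a)" for a
    define I' where "I' = insert i (I - {pick I j})"
    have fin: "finite I" by (rule finite_index[OF I(1)])
    have pj: "pick I j \<in> I" using ij I(2) by (simp add: pick_in_set_le)
    have bp: "bij_betw (pick I) {..<k} I" using bij_betw_pick[OF fin] I(2) by simp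
    have "bij_betw (pick I) ({..<k} - {j}) (I - {pick I j})"
      using bij_betw_DiffI[OF bp, of "{j}" "{pick I j}"] ij pj by (simp add: bij_betw_def)
    then have "bij_betw f ({..<k} - {j}) (I - {pick I j})"
      by (rule bij_betw_cong[THEN iffD1, rotated]) (simp add: f_def)
    moreover have "f j = i" by (simp add: f_def)
    ultimately have bf: "bij_betw f {..<k} I'"
      using False notIn_Un_bij_betw[of j "{..<k} - {j}" f "I - {pick I j}"] ij
      by (simp add: I'_def insert_absorb)
    have cI': "card I' = k" and I': "I' \<subseteq> {..<n}"
      using bij_betw_same_card[OF bf] I ij by (auto simp: I'_def)
    have fin': "finite I'" using I' finite_subset by blast
    have sub: "submatrix W T UNIV = mat k k (\<lambda>(a, b). W $$ (pick T a, b))"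
      if "T \<subseteq> {..<n}" "card T = k" for T
      using W that by (simp add: submatrix_def pick_UNIV card_index)
    have "volume (submatrix W I' UNIV) \<le> volume (submatrix W I UNIV)"
      using max I' cI' I(2) W unfolding max_volume_rows_def by auto
    then have le: "cmod (det (mat k k (\<lambda>(a, b). W $$ (pick I' a, b))))
        \<le> cmod (det (mat k k (\<lambda>(a, b). W $$ (pick I a, b))))"
      unfolding sub[OF I' cI'] sub[OF I] volume_eq_det[OF mat_carrier] .
    have WI_eq: "mat k k (\<lambda>(a, b). W $$ (pick I a, b)) = ?WI"
      using W rows I(2) by (intro eq_matI) (auto simp del: index_mult_mat(1))
    define x where "x = row ?X i"
    have x: "x \<in> carrier_vec k" using row_carrier[of ?X i] Z by (simp add: x_def)
    have XW: "?X * ?WI = W"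
    proof -
      have "Z * ?WI = 1\<^sub>m k"
        by (rule mat_mult_left_right_inverse[OF WI Z inv])
      then show ?thesis
        using assoc_mult_mat[OF W Z WI] W by simp
    qed
    have WIx: "(?WI\<^sup>T *\<^sub>v x) $ b = W $$ (i, b)" if b: "b < k" for b
    proof -
      have "(?WI\<^sup>T *\<^sub>v x) $ b = (\<Sum>l<k. ?X $$ (i, l) * ?WI $$ (l, b))"
        unfolding transpose_mult_vec_index[OF WI x b]
        using W Z ij by (intro sum.cong) (auto simp: x_def)
      also have "\<dots> = (?X * ?WI) $$ (i, b)"
        by (rule mult_index_sum[OF X WI ij(1) b, symmetric])
      finally show ?thesis using XW by simp
    qed
    have "mat k k (\<lambda>(a, b). W $$ (f a, b)) = (replace_col (?WI\<^sup>T) (?WI\<^sup>T *\<^sub>v x) j)\<^sup>T"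
      using W I(2) WIx rows
      by (intro eq_matI) (auto simp: replace_col_def f_def simp del: index_mult_mat(1) index_mult_mat_vec)
    then have "det (mat k k (\<lambda>(a, b). W $$ (f a, b))) = det (replace_col (?WI\<^sup>T) (?WI\<^sup>T *\<^sub>v x) j)"
      using det_transpose[of "replace_col (?WI\<^sup>T) (?WI\<^sup>T *\<^sub>v x) j" k] W I(2)
      by (simp only:) (simp add: replace_col_def)
    also have "\<dots> = x $ j * det (?WI\<^sup>T)"
      using WI x ij by (intro cramer_lemma_mat) auto
    also have "det (?WI\<^sup>T) = det ?WI"
      by (rule det_transpose[OF WI])
    also have "x $ j = ?X $$ (i, j)"
      using W Z ij by (simp add: x_def)
    finally have "cmod (det (mat k k (\<lambda>(a, b). W $$ (f a, b)))) = cmod (?X $$ (i, j)) * cmod (det ?WI)"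
      by (simp add: norm_mult)
    also have "cmod (det (mat k k (\<lambda>(a, b). W $$ (f a, b))))
        = cmod (det (mat k k (\<lambda>(a, b). W $$ (pick I' a, b))))"
      using bij_betw_pick[OF fin'] cI' by (intro cmod_det_reindex_rows[OF bf]) simp
    finally have "cmod (?X $$ (i, j)) * cmod (det ?WI) \<le> 1 * cmod (det ?WI)"
      using le WI_eq by simp
    moreover have "det ?WI \<noteq> 0"
      using det_mult[OF WI Z] inv by auto
    ultimately show ?thesis by simp
  qed
qed

section \<open>The spectral bound from entrywise bounds\<close>

text \<open>Lagrange's identity, the sum-of-squares form of the Cauchy-Schwarz inequality, in matrix form:
  for a row vector \<open>x\<close> of length \<open>k\<close> the matrix \<open>\<bar>x\<bar>\<^sup>2 1 - x\<^sup>H x\<close> is the Gram matrix of the \<open>k\<^sup>2\<close> rows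
  \<open>r a b\<close>. The factor \<open>1 / sqrt 2\<close> accounts for each pair occurring in both orders.\<close>

lemma lagrange_identity_polarized:
  fixes x :: "nat \<Rightarrow> complex"
  assumes jl: "j < k" "l < k"
  defines "r \<equiv> \<lambda>a b j. complex_of_real (1 / sqrt 2) *
      (cnj (x a) * (if b = j then 1 else 0) - cnj (x b) * (if a = j then 1 else 0))"
  shows "(\<Sum>a<k. \<Sum>b<k. cnj (r a b j) * r a b l)
    = (if j = l then complex_of_real (\<Sum>a<k. (cmod (x a))\<^sup>2) else 0) - cnj (x j) * x l"
proof -
  let ?d = "\<lambda>a b. if a = b then 1 else 0 :: complex"
  have half: "complex_of_real (1 / sqrt 2) * complex_of_real (1 / sqrt 2) = 1 / 2"
    by (simp flip: of_real_mult)
  have delta: "(\<Sum>a<k. f a * ?d a j) = f j" if "j < k" for f :: "nat \<Rightarrow> complex" and j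
    using that by (simp add: if_distrib cong: if_cong)
  have "cnj (r a b j) * r a b l = 1 / 2 *
      ((x a * cnj (x a) * ?d b l) * ?d b j - (x a * ?d a l * cnj (x b)) * ?d b j
       - (x b * cnj (x a) * ?d b l) * ?d a j + (x b * cnj (x b) * ?d a l) * ?d a j)" for a b
    unfolding r_def half[symmetric] by (simp add: algebra_simps)
  then have "(\<Sum>a<k. \<Sum>b<k. cnj (r a b j) * r a b l) = 1 / 2 *
      ((\<Sum>a<k. \<Sum>b<k. (x a * cnj (x a) * ?d b l) * ?d b j)
       - (\<Sum>a<k. \<Sum>b<k. (x a * ?d a l * cnj (x b)) * ?d b j)
       - (\<Sum>a<k. \<Sum>b<k. (x b * cnj (x a) * ?d b l) * ?d a j)
       + (\<Sum>a<k. \<Sum>b<k. (x b * cnj (x b) * ?d a l) * ?d a j))"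
    by (simp only: sum.distrib sum_subtractf sum_distrib_left[of "1 / 2", symmetric])
  also have "(\<Sum>a<k. \<Sum>b<k. (x b * cnj (x a) * ?d b l) * ?d a j)
      = (\<Sum>b<k. \<Sum>a<k. (x b * cnj (x a) * ?d b l) * ?d a j)"
    by (rule sum.swap)
  also have "(\<Sum>a<k. \<Sum>b<k. (x b * cnj (x b) * ?d a l) * ?d a j)
      = (\<Sum>b<k. \<Sum>a<k. (x b * cnj (x b) * ?d a l) * ?d a j)"
    by (rule sum.swap)
  also have "(\<Sum>a<k. \<Sum>b<k. (x a * ?d a l * cnj (x b)) * ?d b j) = (\<Sum>a<k. (x a * cnj (x j)) * ?d a l)"
    unfolding delta[OF jl(1)] by (simp only: mult_ac)
  also have "1 / 2 * ((\<Sum>a<k. \<Sum>b<k. (x a * cnj (x a) * ?d b l) * ?d b j)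
       - (\<Sum>a<k. (x a * cnj (x j)) * ?d a l)
       - (\<Sum>b<k. \<Sum>a<k. (x b * cnj (x a) * ?d b l) * ?d a j)
       + (\<Sum>b<k. \<Sum>a<k. (x b * cnj (x b) * ?d a l) * ?d a j))
     = 1 / 2 * ((\<Sum>a<k. x a * cnj (x a) * ?d j l) - x l * cnj (x j) - x l * cnj (x j)
       + (\<Sum>a<k. x a * cnj (x a) * ?d j l))"
    unfolding delta[OF jl(1)] delta[OF jl(2)] ..
  also have "\<dots> = (\<Sum>a<k. x a * cnj (x a)) * ?d j l - x l * cnj (x j)"
    unfolding sum_distrib_right[symmetric] by (simp add: field_simps)
  also have "(\<Sum>a<k. x a * cnj (x a)) = complex_of_real (\<Sum>a<k. (cmod (x a))\<^sup>2)"
    by (simp flip: complex_norm_square)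
  finally show ?thesis by (simp add: mult.commute)
qed

context scalar_field
begin

lemma gram_of_family:
  assumes A: "finite A" and r: "\<And>a j. a \<in> A \<Longrightarrow> j < q \<Longrightarrow> r a j \<in> K"
  shows "\<exists>p. \<exists>N \<in> K_mat K p q.
    \<forall>i<q. \<forall>j<q. (N\<^sup>H * N) $$ (i, j) = (\<Sum>a\<in>A. cnj (r a i) * r a j)"
proof -
  obtain h where h: "bij_betw h {..<card A} A"
    using ex_bij_betw_nat_finite[OF A] by (auto simp: atLeast0LessThan)
  define N where "N = mat (card A) q (\<lambda>(l, j). r (h l) j)"
  have hA: "h l \<in> A" if "l < card A" for l
    using h that by (auto simp: bij_betw_def)
  have N: "N \<in> K_mat K (card A) q"
    unfolding N_def by (rule K_mat_matI) (auto intro: r hA)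
  have "(N\<^sup>H * N) $$ (i, j) = (\<Sum>a\<in>A. cnj (r a i) * r a j)" if "i < q" "j < q" for i j
  proof -
    have "(N\<^sup>H * N) $$ (i, j) = (\<Sum>l<card A. cnj (r (h l) i) * r (h l) j)"
      unfolding gram_index[OF K_mat_carrier[OF N] that] using that by (simp add: N_def)
    also have "\<dots> = (\<Sum>a\<in>A. cnj (r a i) * r a j)"
      by (rule sum.reindex_bij_betw[OF h])
    finally show ?thesis .
  qed
  with N show ?thesis by blast
qed

text \<open>The rows in \<open>I\<close> contribute the identity to \<open>X\<^sup>H X\<close>. Each of the other \<open>n - k\<close> rows \<open>x\<close> has entries of
  modulus at most 1, so \<open>k 1 - x\<^sup>H x\<close> is a Gram matrix: Lagrange's identity gives
  \<open>\<bar>x\<bar>\<^sup>2 1 - x\<^sup>H x\<close>, and \<open>(k - \<bar>x\<bar>\<^sup>2) 1\<close> is a nonnegative multiple of the identity. Their sum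
  complements \<open>X\<^sup>H X\<close> to \<open>(1 + k (n - k)) 1\<close>. All rows used are explicit and have entries in \<open>K\<close>, so
  no singular value decomposition of \<open>X\<close> over \<open>K\<close> is involved.\<close>

lemma gram_complement:
  assumes X: "X \<in> K_mat K n k" and I: "I \<subseteq> {..<n}" "card I = k"
    and id: "(selector n I)\<^sup>H * X = 1\<^sub>m k"
    and bound: "\<And>i j. i < n \<Longrightarrow> j < k \<Longrightarrow> cmod (X $$ (i, j)) \<le> 1"
  shows "\<exists>p. \<exists>N \<in> K_mat K p k.
    X\<^sup>H * X + N\<^sup>H * N = complex_of_real (1 + real k * (real n - real k)) \<cdot>\<^sub>m 1\<^sub>m k"
proof -
  have Xc: "X \<in> carrier_mat n k" using X by auto
  define T where "T = {..<n} - I"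
  have finI: "finite I" by (rule finite_index[OF I(1)])
  have cT: "real (card T) = real n - real k"
    using I finI card_mono[OF _ I(1)] by (simp add: T_def card_Diff_subset of_nat_diff)
  define sq where "sq i = (\<Sum>a<k. (cmod (X $$ (i, a)))\<^sup>2)" for i
  have sq_le: "sq i \<le> real k" if "i \<in> T" for i
  proof -
    have "sq i \<le> (\<Sum>a<k. 1)"
      unfolding sq_def using bound that by (intro sum_mono) (auto simp: T_def power_le_one)
    then show ?thesis by simp
  qed
  define r where "r = (\<lambda>(i, a, b) (j :: nat). complex_of_real (1 / sqrt 2) *
      (cnj (X $$ (i, a)) * (if b = j then 1 else 0) - cnj (X $$ (i, b)) * (if a = j then 1 else 0)))"
  define r' where "r' = (\<lambda>(i, a) (j :: nat). complex_of_real (sqrt (real k - sq i)) * (if a = j then 1 else 0))"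
  have XK: "X $$ (i, j) \<in> K" if "i < n" "j < k" for i j
    using X that by (auto simp: K_mat_iff)
  \<comment> \<open>The rows from Lagrange's identity, for every row of \<open>X\<close> outside \<open>I\<close>.\<close>
  obtain p1 N1 where N1: "N1 \<in> K_mat K p1 k"
    "\<And>i j. i < k \<Longrightarrow> j < k \<Longrightarrow>
      (N1\<^sup>H * N1) $$ (i, j) = (\<Sum>z\<in>T \<times> {..<k} \<times> {..<k}. cnj (r z i) * r z j)"
  proof -
    have "r z j \<in> K" if z_in: "z \<in> T \<times> {..<k} \<times> {..<k}" for z j
    proof -
      obtain i a b where z: "z = (i, a, b)" "i < n" "a < k" "b < k"
        using z_in by (auto simp: T_def)
      show ?thesis
        unfolding z(1) r_def prod.case
        by (rule K_closed(6)[OF K_closed(3)]) (use XK z in auto)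
    qed
    then show thesis
      using gram_of_family[of "T \<times> {..<k} \<times> {..<k}" k r] that by (auto simp: T_def)
  qed
  \<comment> \<open>The rows making up \<open>(k - \<bar>x\<bar>\<^sup>2) 1\<close>, for every row of \<open>X\<close> outside \<open>I\<close>.\<close>
  obtain p2 N2 where N2: "N2 \<in> K_mat K p2 k"
    "\<And>i j. i < k \<Longrightarrow> j < k \<Longrightarrow> (N2\<^sup>H * N2) $$ (i, j) = (\<Sum>z\<in>T \<times> {..<k}. cnj (r' z i) * r' z j)"
  proof -
    have "r' z j \<in> K" if "z \<in> T \<times> {..<k}" "j < k" for z j
      using that by (auto simp: r'_def intro!: K_closed)
    then show thesis
      using gram_of_family[of "T \<times> {..<k}" k r'] that by (auto simp: T_def)
  qed
  have N1c: "N1 \<in> carrier_mat p1 k" and N2c: "N2 \<in> carrier_mat p2 k"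
    using N1 N2 by auto
  define N where "N = stack N1 N2"
  have N: "N \<in> K_mat K (p1 + p2) k"
    unfolding N_def by (rule K_mat_stack[OF N1(1) N2(1)])
  have "X\<^sup>H * X + N\<^sup>H * N = complex_of_real (1 + real k * (real n - real k)) \<cdot>\<^sub>m 1\<^sub>m k"
  proof (rule eq_matI)
    fix j l assume "j < dim_row (complex_of_real (1 + real k * (real n - real k)) \<cdot>\<^sub>m 1\<^sub>m k)"
      "l < dim_col (complex_of_real (1 + real k * (real n - real k)) \<cdot>\<^sub>m 1\<^sub>m k)"
    then have jl: "j < k" "l < k" by auto
    let ?d = "if j = l then 1 else 0 :: complex"
    have "(X\<^sup>H * X) $$ (j, l)
        = (\<Sum>i\<in>I. cnj (X $$ (i, j)) * X $$ (i, l)) + (\<Sum>i\<in>T. cnj (X $$ (i, j)) * X $$ (i, l))"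
      unfolding gram_index[OF Xc jl] T_def
      using I(1) by (subst sum.subset_diff[of I]) (auto simp: add.commute)
    also have "(\<Sum>i\<in>I. cnj (X $$ (i, j)) * X $$ (i, l))
        = (\<Sum>a<k. cnj (X $$ (pick I a, j)) * X $$ (pick I a, l))"
      using sum.reindex_bij_betw[OF bij_betw_pick[OF finI], symmetric] I(2) by simp
    also have "\<dots> = (\<Sum>a<k. if a = j then ?d else 0)"
    proof (rule sum.cong)
      fix a assume a: "a \<in> {..<k}"
      have "X $$ (pick I a, b) = (if a = b then 1 else 0)" if "b < k" for b
        using selector_adj_mult_index[OF I(1) Xc, of a b] a that I(2) id by simp
      then show "cnj (X $$ (pick I a, j)) * X $$ (pick I a, l) = (if a = j then ?d else 0)"
        using jl by simp
    qed simp
    also have "\<dots> = ?d" using jl by simp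
    finally have gram_X: "(X\<^sup>H * X) $$ (j, l) = ?d + (\<Sum>i\<in>T. cnj (X $$ (i, j)) * X $$ (i, l))" .
    have "(N1\<^sup>H * N1) $$ (j, l)
        = (\<Sum>i\<in>T. \<Sum>a<k. \<Sum>b<k. cnj (r (i, a, b) j) * r (i, a, b) l)"
      unfolding N1(2)[OF jl] by (simp add: sum.cartesian_product split_def)
    also have "\<dots> = (\<Sum>i\<in>T. (if j = l then complex_of_real (sq i) else 0)
        - cnj (X $$ (i, j)) * X $$ (i, l))"
      by (simp only: r_def prod.case lagrange_identity_polarized[OF jl] sq_def)
    finally have gram_N1: "(N1\<^sup>H * N1) $$ (j, l) =
        (\<Sum>i\<in>T. (if j = l then complex_of_real (sq i) else 0) - cnj (X $$ (i, j)) * X $$ (i, l))" .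
    have "(N2\<^sup>H * N2) $$ (j, l) = (\<Sum>i\<in>T. \<Sum>a<k. cnj (r' (i, a) j) * r' (i, a) l)"
      unfolding N2(2)[OF jl] by (simp add: sum.cartesian_product split_def)
    also have "\<dots> = (\<Sum>i\<in>T. \<Sum>a<k. if a = j then complex_of_real (real k - sq i) * ?d else 0)"
    proof (intro sum.cong refl)
      fix i a assume "i \<in> T" "a \<in> {..<k}"
      then have "complex_of_real (sqrt (real k - sq i)) * complex_of_real (sqrt (real k - sq i))
          = complex_of_real (real k - sq i)"
        using sq_le[of i] by (simp flip: of_real_mult)
      then show "cnj (r' (i, a) j) * r' (i, a) l
          = (if a = j then complex_of_real (real k - sq i) * ?d else 0)"
        by (simp add: r'_def)
    qed
    finally have gram_N2: "(N2\<^sup>H * N2) $$ (j, l) = (\<Sum>i\<in>T. complex_of_real (real k - sq i) * ?d)"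
      using jl by simp
    have "(X\<^sup>H * X + N\<^sup>H * N) $$ (j, l)
        = (X\<^sup>H * X) $$ (j, l) + ((N1\<^sup>H * N1) $$ (j, l) + (N2\<^sup>H * N2) $$ (j, l))"
      unfolding N_def gram_stack[OF N1c N2c] using jl Xc N1c N2c by (simp del: index_mult_mat(1))
    also have "\<dots> = ?d + (\<Sum>i\<in>T. complex_of_real (real k) * ?d)"
      unfolding gram_X gram_N1 gram_N2 add.assoc sum.distrib[symmetric]
      by (intro arg_cong2[of _ _ _ _ "(+)"] sum.cong) auto
    also have "\<dots> = complex_of_real (1 + real k * real (card T)) * ?d"
      by (simp add: algebra_simps)
    finally show "(X\<^sup>H * X + N\<^sup>H * N) $$ (j, l)
        = (complex_of_real (1 + real k * (real n - real k)) \<cdot>\<^sub>m 1\<^sub>m k) $$ (j, l)"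
      using jl by (simp add: cT)
  qed (use Xc N in \<open>auto simp: K_mat_iff\<close>)
  with N show ?thesis by blast
qed

end

section \<open>Inverting the core submatrix\<close>

lemma pick_lessThan: "a < k \<Longrightarrow> pick {..<k} a = a"
  using pick_reduce_set[of a k UNIV] by (simp add: pick_UNIV lessThan_def)

lemma submatrix_lessThan:
  assumes B: "B \<in> carrier_mat k k"
  shows "submatrix B UNIV {..<k} = B" "submatrix B {..<k} {..<k} = B"
  using B by (auto simp: submatrix_def pick_UNIV pick_lessThan lessThan_def intro!: eq_matI
      simp flip: lessThan_def)

text \<open>For a \<open>k \<times> k\<close> matrix the truncation of order \<open>k\<close> keeps all columns and singular values.\<close>

lemma truncated_svd_full:
  assumes B: "B \<in> carrier_mat k k" and svd: "truncated_svd K k B Bk"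
  shows "Bk = B"
proof -
  obtain W V where WV: "W \<in> carrier_mat k k" "V \<in> carrier_mat k k"
    and B_eq: "B = W * sv_diag k k B * V\<^sup>H"
    and Bk: "Bk = submatrix W UNIV {..<k} * submatrix (sv_diag k k B) {..<k} {..<k}
      * (submatrix V UNIV {..<k})\<^sup>H"
    using svd B unfolding truncated_svd_def K_unitary_def K_mat_def by auto
  have D: "sv_diag k k B \<in> carrier_mat k k" by (simp add: sv_diag_def)
  have "Bk = W * sv_diag k k B * V\<^sup>H"
    unfolding Bk submatrix_lessThan[OF WV(1)] submatrix_lessThan[OF WV(2)] submatrix_lessThan[OF D] ..
  also note B_eq[symmetric]
  finally show ?thesis .
qed

lemma pinv_inverse:
  assumes B: "B \<in> carrier_mat k k" and X: "X \<in> carrier_mat k k"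
    and inv: "B * X = 1\<^sub>m k" "X * B = 1\<^sub>m k"
  shows "pinv B = X"
  unfolding pinv_def
proof (rule the_equality)
  show "is_pinv B X"
    using B X inv by (auto simp: is_pinv_def)
next
  fix Y assume Y: "is_pinv B Y"
  then have Yc: "Y \<in> carrier_mat k k" and BYB: "B * Y * B = B"
    using B by (auto simp: is_pinv_def)
  have "B * Y = B * Y * (B * X)" using B Yc inv by simp
  also have "\<dots> = B * Y * B * X"
    using B X Yc by (intro assoc_mult_mat[symmetric, of _ k k _ k _ k]) auto
  finally have BY: "B * Y = 1\<^sub>m k" using BYB inv by simp
  have "Y = X * B * Y" using Yc inv by simp
  also have "\<dots> = X * (B * Y)"
    using B X Yc by (intro assoc_mult_mat[of _ k k _ k _ k]) auto
  finally show "Y = X" using BY X by simp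
qed

section \<open>The error of the perturbed cross approximation\<close>

lemma add_mat_shift:
  fixes A B D :: "complex mat"
  assumes "A \<in> carrier_mat p q" "B \<in> carrier_mat p q" "D \<in> carrier_mat p q"
  shows "A + B = (A + D) + (B - D)"
  by (rule eq_matI, insert assms) auto

text \<open>With \<open>P\<close> selecting rows and \<open>Q\<close> selecting columns, \<open>A Q = X U\<close> and \<open>P A = U Y\<close>. In terms of the
  perturbed core \<open>U' = U + P E Q\<close> this reads \<open>(A + E) Q = X U' + F\<close> and \<open>P (A + E) = U' Y + G\<close>, so the
  product with \<open>T = U'\<^sup>-\<^sup>1\<close> expands to \<open>X U' Y + X G + F Y + F T G\<close>, in which the inverse survives
  only in the term that is quadratic in \<open>E\<close>.\<close>

lemma cross_approximation_error:
  fixes A E P Q T U X Y :: "complex mat"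
  assumes X: "X \<in> carrier_mat n k" and Y: "Y \<in> carrier_mat k n" and U: "U \<in> carrier_mat k k"
    and E: "E \<in> carrier_mat n n" and P: "P \<in> carrier_mat k n" and Q: "Q \<in> carrier_mat n k"
    and PX: "P * X = 1\<^sub>m k" and YQ: "Y * Q = 1\<^sub>m k" and A: "A = X * (U * Y)"
    and T: "T \<in> carrier_mat k k"
    and inv: "(U + P * (E * Q)) * T = 1\<^sub>m k" "T * (U + P * (E * Q)) = 1\<^sub>m k"
  defines "F \<equiv> E * Q - X * (P * (E * Q))" and "G \<equiv> P * E - P * (E * Q) * Y"
  shows "A - ((A + E) * Q) * T * (P * (A + E))
    = (X * (P * (E * Q) * Y) - X * (P * E) - E * Q * Y) - F * (T * G)"
proof -
  define M where "M = P * (E * Q)"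
  define U' where "U' = U + M"
  define H where "H = T * G"
  have M: "M \<in> carrier_mat k k" and EQ: "E * Q \<in> carrier_mat n k" and PE: "P * E \<in> carrier_mat k n"
    using E P Q by (auto simp: M_def)
  have U': "U' \<in> carrier_mat k k" using U M by (simp add: U'_def)
  have MY: "M * Y \<in> carrier_mat k n" and UY: "U * Y \<in> carrier_mat k n" using M U Y by auto
  have G: "G \<in> carrier_mat k n" unfolding G_def M_def[symmetric] using MY by (rule minus_carrier_mat)
  have F: "F \<in> carrier_mat n k" unfolding F_def M_def[symmetric] using X M by (intro minus_carrier_mat) auto
  have H: "H \<in> carrier_mat k n" using T G by (simp add: H_def)
  have Ac: "A \<in> carrier_mat n n" using A X U Y by simp
  have inv': "U' * T = 1\<^sub>m k" "T * U' = 1\<^sub>m k"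
    using inv by (simp_all add: U'_def M_def)
  have AQ: "A * Q = X * U"
  proof -
    have "A * Q = X * (U * Y * Q)"
      unfolding A using X UY Q by (intro assoc_mult_mat[of _ n k _ n _ k]) auto
    also have "U * Y * Q = U * (Y * Q)"
      using U Y Q by (intro assoc_mult_mat[of _ k k _ n _ k]) auto
    finally show ?thesis by (simp add: YQ right_mult_one_mat[OF U])
  qed
  have PA: "P * A = U * Y"
  proof -
    have "P * A = P * X * (U * Y)"
      unfolding A using X UY P by (intro assoc_mult_mat[symmetric, of _ k n _ k _ n]) auto
    then show ?thesis by (simp only: PX left_mult_one_mat[OF UY])
  qed
  have XU': "X * U' = X * U + X * M"
    unfolding U'_def using X U M by (intro mult_add_distrib_mat) auto
  have U'Y: "U' * Y = U * Y + M * Y"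
    unfolding U'_def using Y U M by (intro add_mult_distrib_mat) auto
  have C: "(A + E) * Q = X * U' + F"
  proof -
    have "(A + E) * Q = X * U + E * Q"
      using Ac E Q AQ by (simp add: add_mult_distrib_mat[of _ n n])
    also have "\<dots> = X * U' + F"
      unfolding XU' F_def M_def[symmetric] using X U M EQ by (intro add_mat_shift) auto
    finally show ?thesis .
  qed
  have R: "P * (A + E) = U' * Y + G"
  proof -
    have "P * (A + E) = U * Y + P * E"
      using Ac E P PA by (simp add: mult_add_distrib_mat[of _ k n _ n])
    also have "\<dots> = U' * Y + G"
      unfolding U'Y G_def M_def[symmetric] by (rule add_mat_shift[OF UY PE MY])
    finally show ?thesis .
  qed
  have TR: "T * (P * (A + E)) = Y + H"
  proof -
    have "T * (P * (A + E)) = T * (U' * Y) + H"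
      unfolding R H_def using T U' Y G by (intro mult_add_distrib_mat[of _ k k _ n]) auto
    also have "T * (U' * Y) = T * U' * Y"
      using T U' Y by (intro assoc_mult_mat[symmetric, of _ k k _ k _ n]) auto
    finally show ?thesis using inv'(2) Y by simp
  qed
  have U'H: "U' * H = G"
  proof -
    have "U' * H = U' * T * G"
      unfolding H_def using T U' G by (intro assoc_mult_mat[symmetric, of _ k k _ k _ n]) auto
    then show ?thesis using inv'(1) G by simp
  qed
  have "(A + E) * Q * T * (P * (A + E)) = (A + E) * Q * (T * (P * (A + E)))"
    using Ac E Q T P by (intro assoc_mult_mat[of _ n k _ k _ n]) (auto intro!: mult_carrier_mat[of _ _ n])
  also have "\<dots> = X * U' * (Y + H) + F * (Y + H)"
    unfolding TR C using X U' F Y H by (intro add_mult_distrib_mat[of _ n k]) auto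
  also have "F * (Y + H) = F * Y + F * H"
    using F Y H by (intro mult_add_distrib_mat[of _ n k]) auto
  also have "X * U' * (Y + H) = X * (U' * (Y + H))"
    using X U' Y H by (intro assoc_mult_mat[of _ n k _ k _ n]) auto
  also have "U' * (Y + H) = U' * Y + G"
    using U' Y H U'H by (simp add: mult_add_distrib_mat[of _ k k _ n])
  also have "U' * Y + G = U * Y + P * E"
    unfolding U'Y G_def M_def[symmetric] by (rule add_mat_shift[OF UY PE MY, symmetric])
  also have "X * (U * Y + P * E) = A + X * (P * E)"
    unfolding A using X UY PE by (intro mult_add_distrib_mat[of _ n k]) auto
  also have "F * Y = E * Q * Y - X * M * Y"
    unfolding F_def M_def[symmetric] using X M Y EQ by (intro minus_mult_distrib_mat[of _ n k]) auto
  also have "X * M * Y = X * (M * Y)"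
    using X M Y by (intro assoc_mult_mat[of _ n k _ k _ n]) auto
  finally have sum: "(A + E) * Q * T * (P * (A + E))
      = A + X * (P * E) + (E * Q * Y - X * (M * Y) + F * H)" .
  have c: "X * (P * E) \<in> carrier_mat n n" "E * Q * Y \<in> carrier_mat n n" "X * (M * Y) \<in> carrier_mat n n"
    "F * H \<in> carrier_mat n n"
    using X PE EQ Y MY F H by auto
  have cancel: "A - (A + B1 + (B2 - B3 + B4)) = (B3 - B1 - B2) - B4"
    if "B1 \<in> carrier_mat n n" "B2 \<in> carrier_mat n n" "B3 \<in> carrier_mat n n" "B4 \<in> carrier_mat n n"
    for B1 B2 B3 B4
    by (rule eq_matI, insert Ac that) auto
  show ?thesis
    unfolding sum H_def[symmetric] M_def[symmetric] by (rule cancel[OF c])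
qed

context admissible
begin

text \<open>Multiplication from the right is reduced to multiplication from the left by taking adjoints. The
  factor \<open>S\<close> serves to keep the matrices square, where the norm is invariant under the adjoint.\<close>

lemma nrm_mult_right_le:
  assumes nk: "1 \<le> n" "1 \<le> k" and c: "0 \<le> c"
    and X: "X \<in> K_mat K n k" and N: "N \<in> K_mat K p k"
    and gram: "X\<^sup>H * X + N\<^sup>H * N = complex_of_real (c\<^sup>2) \<cdot>\<^sub>m 1\<^sub>m k"
    and S: "S \<in> K_mat K n k" and iso: "S\<^sup>H * S = 1\<^sub>m k" and B: "B \<in> K_mat K n n"
  shows "nrm (B * (S * X\<^sup>H)) \<le> c * nrm B"
proof -
  have cr: "X \<in> carrier_mat n k" "S \<in> carrier_mat n k" "B \<in> carrier_mat n n"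
    using X S B by auto
  have "(B * (S * X\<^sup>H))\<^sup>H = (S * X\<^sup>H)\<^sup>H * B\<^sup>H"
    using cr by (intro adj_mult) auto
  also have "(S * X\<^sup>H)\<^sup>H = X * S\<^sup>H"
    using cr by (subst adj_mult[of _ n k _ n]) auto
  also have "X * S\<^sup>H * B\<^sup>H = X * (S\<^sup>H * B\<^sup>H)"
    using cr by (intro assoc_mult_mat[of _ n k _ n _ n]) auto
  finally have adj: "(B * (S * X\<^sup>H))\<^sup>H = X * (S\<^sup>H * B\<^sup>H)" .
  have "nrm (B * (S * X\<^sup>H)) = nrm (X * (S\<^sup>H * B\<^sup>H))"
    unfolding adj[symmetric]
    by (intro nrm_adj[OF nk(1), symmetric] K_mat_mult[of _ n n] K_mat_mult[of _ n k] B S K_mat_adj X)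
  also have "\<dots> \<le> c * nrm (S\<^sup>H * B\<^sup>H)"
    using S B by (intro nrm_mult_le[OF nk(1,2,1) c X N _ gram] K_mat_intros)
  also have "nrm (S\<^sup>H * B\<^sup>H) \<le> nrm (B\<^sup>H)"
    using B by (intro nrm_coisometry_mult[OF nk(1,2,1) S _ iso] K_mat_intros)
  also have "\<dots> = nrm B"
    by (rule nrm_adj[OF nk(1) B])
  finally show ?thesis using c by (simp add: mult_left_mono)
qed

text \<open>Weyl's inequality for the smallest singular value: apply both \<open>U\<close> and its perturbation to the
  \<open>j\<close>-th right singular vector \<open>v\<close> of the latter. One has length \<open>\<bar>\<sigma> B (j + 1)\<bar>\<close>, the other is at least
  \<open>\<sigma> U k\<close>, and they differ by at most \<open>nrm E\<close>, because the norm is normalized and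
  submultiplicative.\<close>

lemma perturbed_singular_value_ge:
  assumes nk: "1 \<le> n" "1 \<le> k" and E: "E \<in> K_mat K n n"
    and S: "S \<in> K_mat K n k" "S\<^sup>H * S = 1\<^sub>m k" and Q: "Q \<in> K_mat K n k" "Q\<^sup>H * Q = 1\<^sub>m k"
    and U: "U \<in> K_mat K k k" and nonneg: "0 \<le> \<sigma> U k"
    and W: "K_unitary K k W" and V: "K_unitary K k V"
    and svd: "U + S\<^sup>H * (E * Q) = W * sv_diag k k B * V\<^sup>H"
    and j: "j < k"
  shows "\<sigma> U k - nrm E \<le> \<bar>\<sigma> B (j + 1)\<bar>"
proof -
  define M where "M = S\<^sup>H * (E * Q)"
  define D where "D = sv_diag k k B"
  define e where "e = mat k 1 (\<lambda>(i, _). if i = j then 1 else 0 :: complex)"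
  have WK: "W \<in> K_mat K k k" and VK: "V \<in> K_mat K k k" and VV: "V\<^sup>H * V = 1\<^sub>m k"
    using W V by (auto simp: K_unitary_def)
  have eK: "e \<in> K_mat K k 1" unfolding e_def by (rule K_mat_matI) auto
  have DK: "D \<in> K_mat K k k" unfolding D_def sv_diag_def by (rule K_mat_matI) auto
  have MK: "M \<in> K_mat K k k" unfolding M_def using S E Q by (auto intro!: K_mat_intros)
  define v where "v = V * e"
  have vK: "v \<in> K_mat K k 1" unfolding v_def by (intro K_mat_mult[OF VK eK])
  have cr: "W \<in> carrier_mat k k" "V \<in> carrier_mat k k" "e \<in> carrier_mat k 1" "D \<in> carrier_mat k k"
    "M \<in> carrier_mat k k" "v \<in> carrier_mat k 1" "U \<in> carrier_mat k k"
    "S \<in> carrier_mat n k" "E \<in> carrier_mat n n" "Q \<in> carrier_mat n k"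
    using WK VK eK DK MK vK U S E Q by auto
  have ne: "nrm e = 1"
  proof -
    have "nrm e = sqrt (\<Sum>i<k. (cmod (e $$ (i, 0)))\<^sup>2)"
      using normalized nk(2) eK unfolding normalized_norm_def by blast
    also have "(\<Sum>i<k. (cmod (e $$ (i, 0)))\<^sup>2) = (\<Sum>i<k. if i = j then 1 else 0)"
      by (intro sum.cong) (auto simp: e_def)
    finally show ?thesis using j by simp
  qed
  have nv: "nrm v = 1"
    unfolding v_def using nrm_isometry_mult[OF nk(2,2) _ VK eK VV] ne by simp
  have De: "D * e = complex_of_real (\<sigma> B (j + 1)) \<cdot>\<^sub>m e"
  proof (rule eq_matI)
    fix i l assume "i < dim_row (complex_of_real (\<sigma> B (j + 1)) \<cdot>\<^sub>m e)"
      "l < dim_col (complex_of_real (\<sigma> B (j + 1)) \<cdot>\<^sub>m e)"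
    then have il: "i < k" "l < 1" using cr by auto
    have "(D * e) $$ (i, l) = (\<Sum>b<k. if b = j then D $$ (i, j) else 0)"
      unfolding mult_index_sum[OF cr(4,3) il] using il by (intro sum.cong) (auto simp: e_def)
    then show "(D * e) $$ (i, l) = (complex_of_real (\<sigma> B (j + 1)) \<cdot>\<^sub>m e) $$ (i, l)"
      using il j by (simp add: D_def sv_diag_def e_def del: index_mult_mat(1))
  qed (use cr in auto)
  have "(U + M) * v = W * D * (V\<^sup>H * v)"
    unfolding M_def svd D_def[symmetric] using cr by (intro assoc_mult_mat[of _ k k _ k _ 1]) auto
  also have "V\<^sup>H * v = V\<^sup>H * V * e"
    unfolding v_def using cr by (intro assoc_mult_mat[symmetric, of _ k k _ k _ 1]) auto
  also have "\<dots> = e" using VV cr by simp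
  also have "W * D * e = W * (D * e)"
    using cr by (intro assoc_mult_mat[of _ k k _ k _ 1]) auto
  finally have UMv: "(U + M) * v = W * (D * e)" .
  have "nrm ((U + M) * v) = nrm (D * e)"
    unfolding UMv by (rule nrm_unitary_mult[OF nk(2) _ K_mat_mult[OF DK eK] W]) simp
  also have "\<dots> = \<bar>\<sigma> B (j + 1)\<bar>"
    unfolding De using nrm_smult[OF nk(2) _ eK, of "complex_of_real (\<sigma> B (j + 1))"] ne by simp
  finally have UMv_nrm: "nrm ((U + M) * v) = \<bar>\<sigma> B (j + 1)\<bar>" .
  have "nrm (M * v) \<le> nrm E"
  proof -
    have "M * v = S\<^sup>H * (E * Q * v)"
      unfolding M_def using cr by (intro assoc_mult_mat[of _ k n _ k _ 1]) auto
    also have "E * Q * v = E * (Q * v)"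
      using cr by (intro assoc_mult_mat[of _ n n _ k _ 1]) auto
    finally have "nrm (M * v) \<le> nrm (E * (Q * v))"
      using nrm_coisometry_mult[OF nk _ S(1) _ S(2), of 1 "E * (Q * v)"] E Q vK
      by (auto intro!: K_mat_intros)
    also have "\<dots> \<le> nrm E * nrm (Q * v)"
      using nrm_submult[OF nk(1,1) E, of 1 "Q * v"] K_mat_mult[OF Q(1) vK] by simp
    also have "nrm (Q * v) = 1"
      using nrm_isometry_mult[OF nk _ Q(1) vK Q(2)] nv by simp
    finally show ?thesis by simp
  qed
  moreover have "\<sigma> U k \<le> nrm (U * v)"
  proof -
    have col_Uv: "col (U * v) 0 = U *\<^sub>v col v 0"
      by (rule col_mult2[OF cr(7) cr(6)]) simp
    have "\<sigma> U k * nrm v \<le> nrm (U * v)"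
      unfolding nrm_vec[OF nk(2) vK] nrm_vec[OF nk(2) K_mat_mult[OF U vK]] col_Uv
      using nk(2) cr(6) by (intro smallest_singular_value_bound[OF cr(7) _ nonneg]) auto
    then show ?thesis using nv by simp
  qed
  moreover have "nrm (U * v) \<le> nrm ((U + M) * v) + nrm (M * v)"
  proof -
    have "U * v = (U + M) * v - M * v"
      using cr by (simp add: add_mult_distrib_mat[of _ k k]) (intro eq_matI; auto)
    then show ?thesis
      using nrm_triangle_minus[OF nk(2) _ K_mat_mult[OF K_mat_add[OF U MK] vK] K_mat_mult[OF MK vK]]
      by simp
  qed
  ultimately show ?thesis using UMv_nrm by simp
qed

text \<open>If the diagonal entries of a singular value decomposition have modulus at least \<open>s\<close>, then
  \<open>T\<^sup>H T - s\<^sup>2 1\<close> is the Gram matrix of \<open>R V\<^sup>H\<close>, with \<open>R\<close> the diagonal matrix of the numbers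
  \<open>sqrt (\<sigma>\<^sup>2 - s\<^sup>2)\<close>. The decomposition is over \<open>K\<close>, hence so is \<open>R V\<^sup>H\<close>.\<close>

lemma svd_gram_ge:
  assumes W: "K_unitary K k W" and V: "K_unitary K k V"
    and svd: "T = W * sv_diag k k B * V\<^sup>H"
    and s: "0 < s" "\<And>j. j < k \<Longrightarrow> s \<le> \<bar>\<sigma> B (j + 1)\<bar>"
  shows "det T \<noteq> 0"
    and "\<exists>N \<in> K_mat K k k. T\<^sup>H * T = complex_of_real (s\<^sup>2) \<cdot>\<^sub>m 1\<^sub>m k + N\<^sup>H * N"
proof -
  define D where "D = sv_diag k k B"
  have WK: "W \<in> K_mat K k k" and VK: "V \<in> K_mat K k k"
    and WW: "W\<^sup>H * W = 1\<^sub>m k" and VV: "V * V\<^sup>H = 1\<^sub>m k"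
    using W V by (auto simp: K_unitary_def)
  have cr: "W \<in> carrier_mat k k" "V \<in> carrier_mat k k" "D \<in> carrier_mat k k"
    using WK VK by (auto simp: D_def sv_diag_def)
  have "det (W\<^sup>H) * det W = 1" "det V * det (V\<^sup>H) = 1"
    using det_mult[of "W\<^sup>H" k W] det_mult[of V k "V\<^sup>H"] WW VV cr by auto
  moreover have "det D \<noteq> 0"
  proof -
    have "upper_triangular D" by (auto simp: D_def sv_diag_def)
    moreover have "0 \<notin> set (diag_mat D)"
      using s by (fastforce simp: diag_mat_def D_def sv_diag_def)
    ultimately show ?thesis
      using det_upper_triangular[of D k] cr by (simp add: prod_list_zero_iff)
  qed
  ultimately show "det T \<noteq> 0"
    using cr unfolding svd D_def[symmetric] by (auto simp: det_mult[of _ k])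
  define R where "R = mat k k
    (\<lambda>(i, j). if i = j then complex_of_real (sqrt ((\<sigma> B (i + 1))\<^sup>2 - s\<^sup>2)) else 0)"
  have RK: "R \<in> K_mat K k k" unfolding R_def by (rule K_mat_matI) auto
  have Rc: "R \<in> carrier_mat k k" using RK by auto
  have DD: "D\<^sup>H * D = complex_of_real (s\<^sup>2) \<cdot>\<^sub>m 1\<^sub>m k + R\<^sup>H * R"
  proof (rule eq_matI)
    fix i j assume "i < dim_row (complex_of_real (s\<^sup>2) \<cdot>\<^sub>m 1\<^sub>m k + R\<^sup>H * R)"
      "j < dim_col (complex_of_real (s\<^sup>2) \<cdot>\<^sub>m 1\<^sub>m k + R\<^sup>H * R)"
    then have ij: "i < k" "j < k" using Rc by auto
    have diag: "(M\<^sup>H * M) $$ (i, j) = (if i = j then complex_of_real ((d i)\<^sup>2) else 0)"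
      if M: "M = mat k k (\<lambda>(i, j). if i = j then complex_of_real (d i) else 0)" for M d
    proof -
      have Mc: "M \<in> carrier_mat k k" by (simp add: M)
      have "(M\<^sup>H * M) $$ (i, j) = (\<Sum>l<k. if l = i then if i = j then complex_of_real ((d i)\<^sup>2) else 0 else 0)"
        unfolding gram_index[OF Mc ij]
        using ij by (intro sum.cong) (auto simp: M power2_eq_square)
      then show ?thesis using ij by simp
    qed
    have "s\<^sup>2 \<le> (\<sigma> B (i + 1))\<^sup>2"
      using s(2)[OF ij(1)] s(1) abs_le_square_iff[of s "\<sigma> B (i + 1)"] by simp
    then have sq: "(sqrt ((\<sigma> B (i + 1))\<^sup>2 - s\<^sup>2))\<^sup>2 = (\<sigma> B (i + 1))\<^sup>2 - s\<^sup>2"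
      by simp
    show "(D\<^sup>H * D) $$ (i, j) = (complex_of_real (s\<^sup>2) \<cdot>\<^sub>m 1\<^sub>m k + R\<^sup>H * R) $$ (i, j)"
      using diag[of D "\<lambda>i. \<sigma> B (i + 1)"] diag[OF R_def, unfolded sq] ij Rc
      by (simp add: D_def sv_diag_def del: index_mult_mat(1) of_real_power flip: of_real_add)
  qed (use cr Rc in auto)
  have WD: "(W * D)\<^sup>H * (W * D) = D\<^sup>H * D"
    by (rule gram_mult_isometry[OF cr(1,3) WW])
  have VH: "V\<^sup>H \<in> carrier_mat k k" using cr by simp
  have "T\<^sup>H * T = V * (D\<^sup>H * D) * V\<^sup>H"
    unfolding svd D_def[symmetric] using gram_mult[of "W * D" k k "V\<^sup>H" k] WD cr by simp
  also have "\<dots> = (V * (complex_of_real (s\<^sup>2) \<cdot>\<^sub>m 1\<^sub>m k) + V * (R\<^sup>H * R)) * V\<^sup>H"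
    unfolding DD using cr Rc by (subst mult_add_distrib_mat[of _ k k _ k]) auto
  also have "\<dots> = V * (complex_of_real (s\<^sup>2) \<cdot>\<^sub>m 1\<^sub>m k) * V\<^sup>H + V * (R\<^sup>H * R) * V\<^sup>H"
    using cr Rc by (intro add_mult_distrib_mat[of _ k k]) (auto intro!: mult_carrier_mat[of _ k k])
  also have "V * (complex_of_real (s\<^sup>2) \<cdot>\<^sub>m 1\<^sub>m k) * V\<^sup>H = complex_of_real (s\<^sup>2) \<cdot>\<^sub>m 1\<^sub>m k"
    by (simp only: mult_smult_distrib[OF cr(2) one_carrier_mat] right_mult_one_mat[OF cr(2)]
        mult_smult_assoc_mat[OF cr(2) VH] VV)
  also have "V * (R\<^sup>H * R) * V\<^sup>H = (R * V\<^sup>H)\<^sup>H * (R * V\<^sup>H)"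
    using gram_mult[OF Rc VH] by simp
  finally show "\<exists>N \<in> K_mat K k k. T\<^sup>H * T = complex_of_real (s\<^sup>2) \<cdot>\<^sub>m 1\<^sub>m k + N\<^sup>H * N"
    using K_mat_mult[OF RK K_mat_adj[OF VK]] by blast
qed

end

context admissible
begin

text \<open>The three terms of the error that are linear in \<open>E\<close> contribute \<open>c\<close>, \<open>c\<close> and \<open>c\<^sup>2\<close> times its norm. In
  the quadratic term \<open>F H\<close> with \<open>H = T G\<close>, both \<open>F\<close> and \<open>G\<close> cost a factor \<open>(1 + c)\<close> times the norm of
  \<open>E\<close>, and \<open>H\<close> is controlled by \<open>G = U' H\<close>, since \<open>U' = U + S\<^sup>H E Q\<close> stretches by at least \<open>s\<close>. The
  bound is multiplied by \<open>s\<close> to avoid a division.\<close>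

lemma cross_approximation_error_bound:
  assumes nk: "1 \<le> n" "1 \<le> k"
    and E: "E \<in> K_mat K n n"
    and S: "S \<in> K_mat K n k" "S\<^sup>H * S = 1\<^sub>m k" and Q: "Q \<in> K_mat K n k" "Q\<^sup>H * Q = 1\<^sub>m k"
    and X: "X \<in> K_mat K n k" "S\<^sup>H * X = 1\<^sub>m k" and Y: "Y \<in> K_mat K n k" "Q\<^sup>H * Y = 1\<^sub>m k"
    and c: "0 \<le> c"
    and N: "N \<in> K_mat K p k" "X\<^sup>H * X + N\<^sup>H * N = complex_of_real (c\<^sup>2) \<cdot>\<^sub>m 1\<^sub>m k"
    and N': "N' \<in> K_mat K p' k" "Y\<^sup>H * Y + N'\<^sup>H * N' = complex_of_real (c\<^sup>2) \<cdot>\<^sub>m 1\<^sub>m k"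
    and U: "U \<in> K_mat K k k" and A: "A = X * (U * Y\<^sup>H)"
    and T: "T \<in> K_mat K k k"
    and inv: "(U + S\<^sup>H * (E * Q)) * T = 1\<^sub>m k" "T * (U + S\<^sup>H * (E * Q)) = 1\<^sub>m k"
    and s: "0 \<le> s" "L \<in> K_mat K k k"
      "(U + S\<^sup>H * (E * Q))\<^sup>H * (U + S\<^sup>H * (E * Q)) = complex_of_real (s\<^sup>2) \<cdot>\<^sub>m 1\<^sub>m k + L\<^sup>H * L"
  shows "s * nrm (A - ((A + E) * Q) * T * (S\<^sup>H * (A + E)))
    \<le> s * ((2 * c + c\<^sup>2) * nrm E) + ((1 + c) * nrm E)\<^sup>2"
proof -
  define M where "M = S\<^sup>H * (E * Q)"
  define F where "F = E * Q - X * M"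
  define G where "G = S\<^sup>H * E - M * Y\<^sup>H"
  define H where "H = T * G"
  let ?\<epsilon> = "nrm E"
  have e0: "0 \<le> ?\<epsilon>" by (rule nrm_nonneg[OF nk(1,1) E])
  have SH: "S\<^sup>H \<in> K_mat K k n" and QH: "Q\<^sup>H \<in> K_mat K k n" and YH: "Y\<^sup>H \<in> K_mat K k n"
    using S Q Y by (auto intro: K_mat_adj)
  have EQ: "E * Q \<in> K_mat K n k" by (rule K_mat_mult[OF E Q(1)])
  have SE: "S\<^sup>H * E \<in> K_mat K k n" by (rule K_mat_mult[OF SH E])
  have M: "M \<in> K_mat K k k" unfolding M_def by (rule K_mat_mult[OF SH EQ])
  have MY: "M * Y\<^sup>H \<in> K_mat K k n" by (rule K_mat_mult[OF M YH])
  have G: "G \<in> K_mat K k n" unfolding G_def by (rule K_mat_minus[OF SE MY])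
  have XM: "X * M \<in> K_mat K n k" by (rule K_mat_mult[OF X(1) M])
  have F: "F \<in> K_mat K n k" unfolding F_def by (rule K_mat_minus[OF EQ XM])
  have H: "H \<in> K_mat K k n" unfolding H_def by (rule K_mat_mult[OF T G])
  have UM: "U + M \<in> K_mat K k k" by (rule K_mat_add[OF U M])
  have QY: "Q * Y\<^sup>H \<in> K_mat K n n" by (rule K_mat_mult[OF Q(1) YH])
  have EQY: "E * (Q * Y\<^sup>H) \<in> K_mat K n n" by (rule K_mat_mult[OF E QY])
  note cr = K_mat_carrier
  note left = nrm_mult_le[OF nk(1,2) _ c X(1) N(1) _ N(2)]
  have right: "nrm (E * (Q * Y\<^sup>H)) \<le> c * ?\<epsilon>"
    by (rule nrm_mult_right_le[OF nk c Y(1) N'(1,2) Q E])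
  have rows: "nrm (S\<^sup>H * D) \<le> nrm D" if "D \<in> K_mat K n r" "1 \<le> r" for D r
    by (rule nrm_coisometry_mult[OF nk that(2) S(1) that(1) S(2)])
  have XSE: "nrm (X * (S\<^sup>H * E)) \<le> c * ?\<epsilon>"
    using left[OF nk(1) SE] rows[OF E nk(1)] c by (meson mult_left_mono order_trans)
  have EQY_assoc: "E * Q * Y\<^sup>H = E * (Q * Y\<^sup>H)"
    by (rule assoc_mult_mat[OF cr[OF E] cr[OF Q(1)] cr[OF YH]])
  have MY_assoc: "M * Y\<^sup>H = S\<^sup>H * (E * (Q * Y\<^sup>H))"
    unfolding M_def EQY_assoc[symmetric] by (rule assoc_mult_mat[OF cr[OF SH] cr[OF EQ] cr[OF YH]])
  have MY_le: "nrm (M * Y\<^sup>H) \<le> c * ?\<epsilon>"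
    unfolding MY_assoc using rows[OF EQY nk(1)] right by simp
  have XMY: "nrm (X * (M * Y\<^sup>H)) \<le> c\<^sup>2 * ?\<epsilon>"
  proof -
    have "nrm (X * (M * Y\<^sup>H)) \<le> c * nrm (M * Y\<^sup>H)"
      by (rule left[OF nk(1) MY])
    also have "\<dots> \<le> c * (c * ?\<epsilon>)"
      using MY_le c by (rule mult_left_mono)
    finally show ?thesis by (simp add: power2_eq_square mult.assoc)
  qed
  have G_le: "nrm G \<le> (1 + c) * ?\<epsilon>"
  proof -
    have "nrm G \<le> nrm (S\<^sup>H * E) + nrm (M * Y\<^sup>H)"
      unfolding G_def by (rule nrm_triangle_minus[OF nk(2,1) SE MY])
    also have "\<dots> \<le> ?\<epsilon> + c * ?\<epsilon>"
      by (intro add_mono rows[OF E nk(1)] MY_le)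
    finally show ?thesis by (simp add: algebra_simps)
  qed
  have UMH: "(U + M) * H = G"
  proof -
    have "(U + M) * H = (U + M) * T * G"
      unfolding H_def by (rule assoc_mult_mat[OF cr[OF UM] cr[OF T] cr[OF G], symmetric])
    also have "(U + M) * T = 1\<^sub>m k" using inv(1) by (simp add: M_def)
    finally show ?thesis using left_mult_one_mat[OF cr[OF G]] by simp
  qed
  have sH: "s * nrm H \<le> (1 + c) * ?\<epsilon>"
  proof -
    have "s * nrm H \<le> nrm ((U + M) * H)"
      using s(3) by (intro nrm_mult_ge[OF nk(2,2,1) s(1) UM s(2) H]) (simp add: M_def)
    then show ?thesis using UMH G_le by simp
  qed
  have FH: "nrm (F * H) \<le> (1 + c) * ?\<epsilon> * nrm H"
  proof -
    have QH: "Q * H \<in> K_mat K n n" by (rule K_mat_mult[OF Q(1) H])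
    have EQH: "E * (Q * H) \<in> K_mat K n n" by (rule K_mat_mult[OF E QH])
    have EQH_le: "nrm (E * (Q * H)) \<le> ?\<epsilon> * nrm H"
      using nrm_submult[OF nk(1,1) E nk(1) QH] nrm_isometry_mult[OF nk nk(1) Q(1) H Q(2)] by simp
    have EQH_assoc: "E * Q * H = E * (Q * H)"
      by (rule assoc_mult_mat[OF cr[OF E] cr[OF Q(1)] cr[OF H]])
    have MH_assoc: "M * H = S\<^sup>H * (E * (Q * H))"
      unfolding M_def EQH_assoc[symmetric] by (rule assoc_mult_mat[OF cr[OF SH] cr[OF EQ] cr[OF H]])
    have MH: "M * H \<in> K_mat K k n" by (rule K_mat_mult[OF M H])
    have "F * H = E * (Q * H) - X * (M * H)"
      unfolding F_def minus_mult_distrib_mat[OF cr[OF EQ] cr[OF XM] cr[OF H]] EQH_assoc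
        assoc_mult_mat[OF cr[OF X(1)] cr[OF M] cr[OF H]] ..
    then have "nrm (F * H) \<le> nrm (E * (Q * H)) + nrm (X * (M * H))"
      using nrm_triangle_minus[OF nk(1,1) EQH K_mat_mult[OF X(1) MH]] by simp
    also have "nrm (X * (M * H)) \<le> c * nrm (M * H)"
      by (rule left[OF nk(1) MH])
    also have "c * nrm (M * H) \<le> c * nrm (E * (Q * H))"
      unfolding MH_assoc by (rule mult_left_mono[OF rows[OF EQH nk(1)] c])
    finally have "nrm (F * H) \<le> (1 + c) * nrm (E * (Q * H))"
      by (simp add: algebra_simps)
    also have "\<dots> \<le> (1 + c) * (?\<epsilon> * nrm H)"
      using c by (intro mult_left_mono EQH_le) simp
    finally show ?thesis by (simp add: mult.assoc)
  qed
  have YQ: "Y\<^sup>H * Q = 1\<^sub>m k"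
    using arg_cong[OF Y(2), of mat_adjoint] adj_mult[OF cr[OF QH] cr[OF Y(1)]] by simp
  have "A - ((A + E) * Q) * T * (S\<^sup>H * (A + E))
      = (X * (M * Y\<^sup>H) - X * (S\<^sup>H * E) - E * Q * Y\<^sup>H) - F * H"
    unfolding M_def F_def G_def H_def
    by (rule cross_approximation_error[OF cr[OF X(1)] cr[OF YH] cr[OF U] cr[OF E] cr[OF SH]
          cr[OF Q(1)] X(2) YQ A cr[OF T] inv])
  also have "nrm \<dots> \<le> nrm (X * (M * Y\<^sup>H)) + nrm (X * (S\<^sup>H * E)) + nrm (E * Q * Y\<^sup>H) + nrm (F * H)"
  proof -
    note k1 = K_mat_mult[OF X(1) MY] and k2 = K_mat_mult[OF X(1) SE] and k3 = K_mat_mult[OF EQ YH]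
      and k4 = K_mat_mult[OF F H]
    show ?thesis
      using nrm_triangle_minus[OF nk(1,1) k1 k2]
        nrm_triangle_minus[OF nk(1,1) K_mat_minus[OF k1 k2] k3]
        nrm_triangle_minus[OF nk(1,1) K_mat_minus[OF K_mat_minus[OF k1 k2] k3] k4]
      by linarith
  qed
  also have "\<dots> \<le> c\<^sup>2 * ?\<epsilon> + c * ?\<epsilon> + c * ?\<epsilon> + (1 + c) * ?\<epsilon> * nrm H"
    using XMY XSE right FH by (simp add: EQY_assoc)
  finally have "s * nrm (A - ((A + E) * Q) * T * (S\<^sup>H * (A + E)))
      \<le> s * (c\<^sup>2 * ?\<epsilon> + c * ?\<epsilon> + c * ?\<epsilon> + (1 + c) * ?\<epsilon> * nrm H)"
    using s(1) by (rule mult_left_mono)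
  also have "\<dots> = s * ((2 * c + c\<^sup>2) * ?\<epsilon>) + (1 + c) * ?\<epsilon> * (s * nrm H)"
    by (simp add: algebra_simps)
  also have "(1 + c) * ?\<epsilon> * (s * nrm H) \<le> (1 + c) * ?\<epsilon> * ((1 + c) * ?\<epsilon>)"
    using sH c e0 by (intro mult_left_mono) auto
  finally show ?thesis by (simp add: power2_eq_square)
qed

end

theorem corollary5p7:
  fixes K :: "complex set"
    and n k :: nat
    and A E A' W S V C R U C' R' U' U'k :: "complex mat"
    and I J :: "nat set"
    and nrm :: "complex mat \<Rightarrow> real"
    and \<mu> \<epsilon> t :: real
  assumes K: "K = \<real> \<or> K = UNIV"
    and A: "A \<in> K_mat K n n"
    and E: "E \<in> K_mat K n n"
    and A': "A' = A + E"
    and k: "mrank A = k" "k \<ge> 1"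
    and svd: "compact_svd K k A W S V"
    and I: "I \<subseteq> {..<n}" "card I = k"
    and J: "J \<subseteq> {..<n}" "card J = k"
    and C: "C = submatrix A UNIV J"
    and R: "R = submatrix A I UNIV"
    and U: "U = submatrix A I J"
    and C': "C' = submatrix A' UNIV J"
    and R': "R' = submatrix A' I UNIV"
    and U': "U' = submatrix A' I J"
    and ranks: "mrank C = k" "mrank U = k" "mrank R = k"
    and nrm: "admissible_norm K nrm"
    and mu: "pinv_perturbation_constant K nrm \<mu>"
    and t: "t = sqrt (1 + real k * (real n - real (card I)) / (real (card I) - real k + 1))"
    and eps: "nrm E \<le> \<epsilon>"
    and maxvol_W: "max_volume_rows W I"
    and maxvol_V: "max_volume_rows V J"
    and sigma_U: "\<sigma> U k > 4 * \<mu> * \<epsilon>"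
    and U'k: "truncated_svd K k U' U'k"
  shows "nrm (A - C' * pinv U'k * R') \<le> (1 / 2 + 3 * t + 9 / 2 * t\<^sup>2) * \<epsilon>"
proof -
  interpret admissible K nrm
    by unfold_locales (fact K, fact nrm)
  have kn: "k \<le> n"
    using I card_mono[of "{..<n}" I] by simp
  have nk: "1 \<le> n" "1 \<le> k" using k(2) kn by auto
  define SI where "SI = selector n I"
  define SJ where "SJ = selector n J"
  have SI: "SI \<in> K_mat K n k" "SI\<^sup>H * SI = 1\<^sub>m k"
    using selector_K_mat[of n I] selector_gram[OF I(1)] I(2) by (simp_all add: SI_def)
  have SJ: "SJ \<in> K_mat K n k" "SJ\<^sup>H * SJ = 1\<^sub>m k"
    using selector_K_mat[of n J] selector_gram[OF J(1)] J(2) by (simp_all add: SJ_def)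
  note cr = K_mat_carrier
  have Ac: "A \<in> carrier_mat n n" and A'c: "A' \<in> carrier_mat n n"
    using cr[OF A] cr[OF E] A' by auto
  have W: "W \<in> K_mat K n k" and V: "V \<in> K_mat K n k" and S_def: "S = sv_diag k k A"
    and A_svd: "A = W * S * V\<^sup>H"
    using svd unfolding compact_svd_def carrier_matD[OF Ac] by blast+
  have S: "S \<in> K_mat K k k"
    unfolding S_def sv_diag_def by (rule K_mat_matI) auto
  have C'_eq: "C' = A' * SJ" and R'_eq: "R' = SI\<^sup>H * A'" and U_eq: "U = SI\<^sup>H * (A * SJ)"
    and U'_eq: "U' = SI\<^sup>H * (A' * SJ)"
    using submatrix_cols[OF J(1) A'c] submatrix_rows[OF I(1) A'c] submatrix_both[OF Ac I(1) J(1)]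
      submatrix_both[OF A'c I(1) J(1)]
    by (simp_all add: C' R' U U' SI_def SJ_def)
  have SIH: "SI\<^sup>H \<in> K_mat K k n" and SJH: "SJ\<^sup>H \<in> K_mat K k n" and VH: "V\<^sup>H \<in> K_mat K k n"
    using SI SJ V by (auto intro: K_mat_adj)
  define WI where "WI = SI\<^sup>H * W"
  define VJ where "VJ = SJ\<^sup>H * V"
  have WI: "WI \<in> K_mat K k k" unfolding WI_def by (rule K_mat_mult[OF SIH W])
  have VJ: "VJ \<in> K_mat K k k" unfolding VJ_def by (rule K_mat_mult[OF SJH V])
  have VJH: "VJ\<^sup>H \<in> K_mat K k k" by (rule K_mat_adj[OF VJ])
  have VJH_eq: "VJ\<^sup>H = V\<^sup>H * SJ"
    unfolding VJ_def using adj_mult[OF cr[OF SJH] cr[OF V]] by simp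
  have WS: "W * S \<in> K_mat K n k" by (rule K_mat_mult[OF W S])
  have SV: "S * VJ\<^sup>H \<in> K_mat K k k" by (rule K_mat_mult[OF S VJH])
  have U_fac: "U = WI * (S * VJ\<^sup>H)"
  proof -
    have "A * SJ = W * S * VJ\<^sup>H"
      unfolding A_svd VJH_eq by (rule assoc_mult_mat[OF cr[OF WS] cr[OF VH] cr[OF SJ(1)]])
    also have "\<dots> = W * (S * VJ\<^sup>H)"
      by (rule assoc_mult_mat[OF cr[OF W] cr[OF S] cr[OF VJH]])
    finally show ?thesis
      unfolding U_eq WI_def using assoc_mult_mat[OF cr[OF SIH] cr[OF W] cr[OF SV]] by simp
  qed
  have U: "U \<in> K_mat K k k" unfolding U_fac by (rule K_mat_mult[OF WI SV])
  have "det U \<noteq> 0"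
    using ranks(2) vec_space.det_rank_iff[OF cr[OF U]] carrier_matD(1)[OF cr[OF U]]
    by (simp add: mrank_def)
  then have dets: "det WI \<noteq> 0" "det VJ \<noteq> 0"
    unfolding U_fac using det_mult[OF cr[OF WI] cr[OF SV]] det_mult[OF cr[OF S] cr[OF VJH]]
      det_adj[OF cr[OF VJ]] by auto
  obtain Z1 where Z1: "Z1 \<in> K_mat K k k" "WI * Z1 = 1\<^sub>m k" "Z1 * WI = 1\<^sub>m k"
    using K_inverse_exists[OF WI dets(1)] by blast
  obtain Z2 where Z2: "Z2 \<in> K_mat K k k" "VJ * Z2 = 1\<^sub>m k" "Z2 * VJ = 1\<^sub>m k"
    using K_inverse_exists[OF VJ dets(2)] by blast
  \<comment> \<open>The factors of \<open>C = X U\<close> and \<open>R = U Y\<^sup>H\<close>.\<close>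
  define X where "X = W * Z1"
  define Y where "Y = V * Z2"
  have X: "X \<in> K_mat K n k" unfolding X_def by (rule K_mat_mult[OF W Z1(1)])
  have Y: "Y \<in> K_mat K n k" unfolding Y_def by (rule K_mat_mult[OF V Z2(1)])
  have YH: "Y\<^sup>H \<in> K_mat K k n" by (rule K_mat_adj[OF Y])
  have Z2H: "Z2\<^sup>H \<in> K_mat K k k" by (rule K_mat_adj[OF Z2(1)])
  have SX: "SI\<^sup>H * X = 1\<^sub>m k"
    unfolding X_def using assoc_mult_mat[OF cr[OF SIH] cr[OF W] cr[OF Z1(1)]] Z1(2) by (simp add: WI_def)
  have SY: "SJ\<^sup>H * Y = 1\<^sub>m k"
    unfolding Y_def using assoc_mult_mat[OF cr[OF SJH] cr[OF V] cr[OF Z2(1)]] Z2(2) by (simp add: VJ_def)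
  have A_fac: "A = X * (U * Y\<^sup>H)"
  proof -
    have YH_eq: "Y\<^sup>H = Z2\<^sup>H * V\<^sup>H"
      unfolding Y_def by (rule adj_mult[OF cr[OF V] cr[OF Z2(1)]])
    have VZ: "VJ\<^sup>H * Z2\<^sup>H = 1\<^sub>m k"
      using adj_mult[OF cr[OF Z2(1)] cr[OF VJ]] Z2(3) by simp
    have SVY: "S * VJ\<^sup>H * Y\<^sup>H = S * V\<^sup>H"
      unfolding YH_eq assoc_mult_mat[OF cr[OF S] cr[OF VJH] mult_carrier_mat[OF cr[OF Z2H] cr[OF VH]]]
        assoc_mult_mat[OF cr[OF VJH] cr[OF Z2H] cr[OF VH], symmetric] VZ left_mult_one_mat[OF cr[OF VH]] ..
    have SVH: "S * V\<^sup>H \<in> K_mat K k n" by (rule K_mat_mult[OF S VH])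
    have WSV: "WI * (S * V\<^sup>H) \<in> K_mat K k n" by (rule K_mat_mult[OF WI SVH])
    have "U * Y\<^sup>H = WI * (S * V\<^sup>H)"
      unfolding U_fac assoc_mult_mat[OF cr[OF WI] cr[OF SV] cr[OF YH]] SVY ..
    then have "X * (U * Y\<^sup>H) = W * (Z1 * (WI * (S * V\<^sup>H)))"
      unfolding X_def using assoc_mult_mat[OF cr[OF W] cr[OF Z1(1)] cr[OF WSV]] by simp
    also have "Z1 * (WI * (S * V\<^sup>H)) = S * V\<^sup>H"
      unfolding assoc_mult_mat[OF cr[OF Z1(1)] cr[OF WI] cr[OF SVH], symmetric] Z1(3)
      by (rule left_mult_one_mat[OF cr[OF SVH]])
    also have "W * (S * V\<^sup>H) = A"
      unfolding A_svd by (rule assoc_mult_mat[OF cr[OF W] cr[OF S] cr[OF VH], symmetric])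
    finally show ?thesis ..
  qed
  have t0: "0 \<le> t" and t2: "t\<^sup>2 = 1 + real k * (real n - real k)"
    using kn by (simp_all add: t I(2))
  obtain p N where N: "N \<in> K_mat K p k" "X\<^sup>H * X + N\<^sup>H * N = complex_of_real (t\<^sup>2) \<cdot>\<^sub>m 1\<^sub>m k"
  proof -
    have "cmod (X $$ (i, j)) \<le> 1" if "i < n" "j < k" for i j
      unfolding X_def
      using max_volume_entries[OF cr[OF W] I maxvol_W cr[OF Z1(1)] _ that] Z1(2)
      by (simp add: WI_def SI_def)
    then show thesis
      using gram_complement[OF X I] SX that unfolding SI_def t2 by blast
  qed
  obtain p' N' where N': "N' \<in> K_mat K p' k" "Y\<^sup>H * Y + N'\<^sup>H * N' = complex_of_real (t\<^sup>2) \<cdot>\<^sub>m 1\<^sub>m k"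
  proof -
    have "cmod (Y $$ (i, j)) \<le> 1" if "i < n" "j < k" for i j
      unfolding Y_def
      using max_volume_entries[OF cr[OF V] J maxvol_V cr[OF Z2(1)] _ that] Z2(2)
      by (simp add: VJ_def SJ_def)
    then show thesis
      using gram_complement[OF Y J] SY that unfolding SJ_def t2 by blast
  qed
  have e0: "0 \<le> nrm E" by (rule nrm_nonneg[OF nk(1,1) E])
  \<comment> \<open>By Weyl's inequality \<open>s\<close> is a lower bound for the singular values of \<open>U'\<close>; the assumption on
    \<open>\<sigma> U k\<close> turns \<open>\<epsilon> / s\<close> into at most \<open>1 / 3\<close>.\<close>
  define s where "s = \<sigma> U k - nrm E"
  have mu1: "1 \<le> \<mu>" using mu by (simp add: pinv_perturbation_constant_def)
  have s_gt: "3 * \<epsilon> < s" and s0: "0 < s"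
  proof -
    have "4 * \<epsilon> \<le> 4 * \<mu> * \<epsilon>"
      using mult_right_mono[OF mu1, of \<epsilon>] e0 eps by simp
    then show "3 * \<epsilon> < s" using sigma_U eps by (simp add: s_def)
    then show "0 < s" using e0 eps by linarith
  qed
  have EJ: "E * SJ \<in> K_mat K n k" and AJ: "A * SJ \<in> K_mat K n k"
    using E A SJ by (auto intro: K_mat_mult)
  have U'_sum: "U' = U + SI\<^sup>H * (E * SJ)"
    unfolding U'_eq U_eq A' add_mult_distrib_mat[OF Ac cr[OF E] cr[OF SJ(1)]]
    by (rule mult_add_distrib_mat[OF cr[OF SIH] cr[OF AJ] cr[OF EJ]])
  have U'K: "U' \<in> K_mat K k k"
    unfolding U'_sum by (intro K_mat_add[OF U] K_mat_mult[OF SIH EJ])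
  obtain P Q where PQ: "K_unitary K k P" "K_unitary K k Q" and U'_svd: "U' = P * sv_diag k k U' * Q\<^sup>H"
    using U'k carrier_matD[OF cr[OF U'K]] unfolding truncated_svd_def by auto
  have "s \<le> \<bar>\<sigma> U' (j + 1)\<bar>" if "j < k" for j
    unfolding s_def
    using perturbed_singular_value_ge[OF nk E SI SJ U _ PQ _ that, of U'] U'_svd U'_sum s0 e0
    by (simp add: s_def)
  note gram = svd_gram_ge[OF PQ U'_svd s0 this]
  obtain L where L: "L \<in> K_mat K k k" "U'\<^sup>H * U' = complex_of_real (s\<^sup>2) \<cdot>\<^sub>m 1\<^sub>m k + L\<^sup>H * L"
    using gram(2) by blast
  obtain T where T: "T \<in> K_mat K k k" "U' * T = 1\<^sub>m k" "T * U' = 1\<^sub>m k"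
    using K_inverse_exists[OF U'K gram(1)] by blast
  have pinv: "pinv U'k = T"
    using truncated_svd_full[OF cr[OF U'K] U'k] pinv_inverse[OF cr[OF U'K] cr[OF T(1)] T(2,3)] by simp
  have "s * nrm (A - C' * pinv U'k * R') \<le> s * ((2 * t + t\<^sup>2) * nrm E) + ((1 + t) * nrm E)\<^sup>2"
    unfolding pinv C'_eq R'_eq A'
    using T(2,3) L(2) s0 unfolding U'_sum
    by (intro cross_approximation_error_bound[OF nk E SI SJ X SX Y SY t0 N N' U A_fac T(1) _ _ _ L(1)])
      auto
  also have "((1 + t) * nrm E)\<^sup>2 \<le> ((1 + t) * \<epsilon>)\<^sup>2"
    using eps e0 t0 by (intro power_mono mult_left_mono) auto
  also have "\<dots> = (1 + t)\<^sup>2 * \<epsilon> * \<epsilon>"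
    by (simp add: power2_eq_square)
  also have "\<dots> \<le> (1 + t)\<^sup>2 * \<epsilon> * (s / 3)"
    using s_gt eps e0 by (intro mult_left_mono) auto
  also have "s * ((2 * t + t\<^sup>2) * nrm E) \<le> s * ((2 * t + t\<^sup>2) * \<epsilon>)"
    using s0 eps t0 by (intro mult_left_mono) auto
  finally have "s * nrm (A - C' * pinv U'k * R') \<le> s * ((2 * t + t\<^sup>2 + (1 + t)\<^sup>2 / 3) * \<epsilon>)"
    by (simp add: algebra_simps)
  then have "nrm (A - C' * pinv U'k * R') \<le> (2 * t + t\<^sup>2 + (1 + t)\<^sup>2 / 3) * \<epsilon>"
    using s0 by simp
  also have "\<dots> \<le> (1 / 2 + 3 * t + 9 / 2 * t\<^sup>2) * \<epsilon>"
  proof (rule mult_right_mono)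
    have "(1 + t)\<^sup>2 = 1 + 2 * t + t\<^sup>2" by (simp add: power2_sum)
    then show "2 * t + t\<^sup>2 + (1 + t)\<^sup>2 / 3 \<le> 1 / 2 + 3 * t + 9 / 2 * t\<^sup>2"
      using t0 zero_le_power2[of t] by linarith
    show "0 \<le> \<epsilon>" using e0 eps by linarith
  qed
  finally show ?thesis .
qed

end
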